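(* Let $n>1$ be an integer and let $\omega_D,\omega_Q\in H^3(V_{2n+1},k^\times)\cong\mathsf{S}^3(x_0,x_1,\dots,x_{2n})/\mathbb{F}_2\langle x_i^2x_j+x_ix_j^2\mid i,j=0,\dots,2n\rangle$ be the classes of $$\omega_D=\sum_{i=1}^n x_0x_{2i-1}x_{2i},\qquad\omega_Q=\sum_{i=1}^n x_0x_{2i-1}x_{2i}+x_0x_1^2+x_0x_2^2 .$$ Then $$\mathsf{Stab}(\omega_D)\cong Sp_{2n}(\mathbb{F}_2)\qquad\text{and}\qquad\mathsf{Stab}(\omega_Q)\cong Sp_{2n}(\mathbb{F}_2).$$
   Context: $k$ is an algebraically closed field of characteristic $0$. $V_{2n+1}$ is the elementary abelian $2$-group of order $2^{2n+1}$, viewed as an $\mathbb{F}_2$-vector space with coordinate functions $x_0,\dots,x_{2n}$. The displayed isomorphism is one of $GL_{2n+1}(\mathbb{F}_2)$-modules; a cubic polynomial corresponds to the image in $H^3(V_{2n+1},k^\times)$ of the class it defines in $H^3(V_{2n+1},\mathbb{F}_2)=\mathsf{S}^3(x_0,\dots,x_{2n})$ via $\mathbb{F}_2\cong\{\pm1\}\subset k^\times$. (These classes arise from the two extra special groups of order $2^{2n+1}$: $D$, the central product of $n$ copies of the dihedral group of order $8$, and $Q$, the central product of $n-1$ copies of the dihedral group of order $8$ and one quaternion group.) $\mathsf{Stab}(\omega)\subset GL_{2n+1}(\mathbb{F}_2)$ is the subgroup of automorphisms $a$ of $V_{2n+1}$ such that $\omega\circ(a\times a\times a)$ is cohomologous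 to $\omega$. $Sp_{2n}(\mathbb{F}_2)$ is the symplectic group. *)

theory Defs
  imports
    "HOL-Algebra.Coset"
    "HOL-Computational_Algebra.Polynomial"
    "HOL-Library.Poly_Mapping"
    "HOL-Library.Z2"
    "Jordan_Normal_Form.VS_Connect"
begin

section \<open>Third group cohomology with trivial coefficients\<close>

text \<open>Inhomogeneous 3-cochains on \<open>G\<close> with values in the abelian group \<open>A\<close>, on which \<open>G\<close> acts
  trivially. They are extensional, so that cochains agreeing on \<open>G\<close> are equal.\<close>

definition cochains3 ::
  "('g, 'm) monoid_scheme \<Rightarrow> ('a, 'n) monoid_scheme \<Rightarrow> ('g \<times> 'g \<times> 'g \<Rightarrow> 'a) monoid" where
  "cochains3 G A =
    \<lparr>carrier = (carrier G \<times> carrier G \<times> carrier G) \<rightarrow>\<^sub>E carrier A,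
     mult = (\<lambda>\<phi> \<psi>. \<lambda>t\<in>carrier G \<times> carrier G \<times> carrier G. \<phi> t \<otimes>\<^bsub>A\<^esub> \<psi> t),
     one = (\<lambda>t\<in>carrier G \<times> carrier G \<times> carrier G. \<one>\<^bsub>A\<^esub>)\<rparr>"

definition cocycles3 ::
  "('g, 'm) monoid_scheme \<Rightarrow> ('a, 'n) monoid_scheme \<Rightarrow> ('g \<times> 'g \<times> 'g \<Rightarrow> 'a) set" where
  "cocycles3 G A =
    {\<omega> \<in> carrier (cochains3 G A).
      \<forall>g\<in>carrier G. \<forall>h\<in>carrier G. \<forall>k\<in>carrier G. \<forall>l\<in>carrier G.
        \<omega> (h, k, l) \<otimes>\<^bsub>A\<^esub> \<omega> (g, h \<otimes>\<^bsub>G\<^esub> k, l) \<otimes>\<^bsub>A\<^esub> \<omega> (g, h, k) =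
        \<omega> (g \<otimes>\<^bsub>G\<^esub> h, k, l) \<otimes>\<^bsub>A\<^esub> \<omega> (g, h, k \<otimes>\<^bsub>G\<^esub> l)}"

definition coboundary2 ::
  "('g, 'm) monoid_scheme \<Rightarrow> ('a, 'n) monoid_scheme \<Rightarrow> ('g \<times> 'g \<Rightarrow> 'a) \<Rightarrow> ('g \<times> 'g \<times> 'g \<Rightarrow> 'a)" where
  "coboundary2 G A \<beta> =
    (\<lambda>(g, h, k)\<in>carrier G \<times> carrier G \<times> carrier G.
      \<beta> (h, k) \<otimes>\<^bsub>A\<^esub> \<beta> (g, h \<otimes>\<^bsub>G\<^esub> k) \<otimes>\<^bsub>A\<^esub> inv\<^bsub>A\<^esub> (\<beta> (g \<otimes>\<^bsub>G\<^esub> h, k) \<otimes>\<^bsub>A\<^esub> \<beta> (g, h)))"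

definition coboundaries3 ::
  "('g, 'm) monoid_scheme \<Rightarrow> ('a, 'n) monoid_scheme \<Rightarrow> ('g \<times> 'g \<times> 'g \<Rightarrow> 'a) set" where
  "coboundaries3 G A = coboundary2 G A ` ((carrier G \<times> carrier G) \<rightarrow>\<^sub>E carrier A)"

definition H3 ::
  "('g, 'm) monoid_scheme \<Rightarrow> ('a, 'n) monoid_scheme \<Rightarrow> ('g \<times> 'g \<times> 'g \<Rightarrow> 'a) set monoid" where
  "H3 G A = ((cochains3 G A)\<lparr>carrier := cocycles3 G A\<rparr>) Mod coboundaries3 G A"

definition cohomology_class ::
  "('g, 'm) monoid_scheme \<Rightarrow> ('a, 'n) monoid_scheme \<Rightarrow> ('g \<times> 'g \<times> 'g \<Rightarrow> 'a) \<Rightarrow>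
    ('g \<times> 'g \<times> 'g \<Rightarrow> 'a) set" where
  "cohomology_class G A \<omega> = coboundaries3 G A #>\<^bsub>cochains3 G A\<^esub> \<omega>"

definition pullback3 ::
  "('g, 'm) monoid_scheme \<Rightarrow> ('g \<Rightarrow> 'g) \<Rightarrow> ('g \<times> 'g \<times> 'g \<Rightarrow> 'a) \<Rightarrow> ('g \<times> 'g \<times> 'g \<Rightarrow> 'a)" where
  "pullback3 G a \<omega> =
    (\<lambda>(g, h, k)\<in>carrier G \<times> carrier G \<times> carrier G. \<omega> (a g, a h, a k))"


section \<open>Elementary abelian 2-groups and linear groups\<close>

abbreviation V2 :: "nat \<Rightarrow> bit vec monoid" where
  "V2 m \<equiv> monoid_vec TYPE(bit) m"

abbreviation field_units :: "'k::field monoid" where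
  "field_units \<equiv> units_of (class_ring :: 'k ring)"

definition GL :: "nat \<Rightarrow> 'a::field mat monoid" where
  "GL m = units_of (ring_mat TYPE('a) m ())"

text \<open>Gram matrix of the standard symplectic form
  \<open>\<Sum>i<n. u\<^sub>2\<^sub>i v\<^sub>2\<^sub>i\<^sub>+\<^sub>1 - u\<^sub>2\<^sub>i\<^sub>+\<^sub>1 v\<^sub>2\<^sub>i\<close>, the basis being ordered by hyperbolic pairs.\<close>

definition symplectic_gram :: "nat \<Rightarrow> 'a::field mat" where
  "symplectic_gram n = mat (2 * n) (2 * n)
    (\<lambda>(i, j). if even i \<and> j = i + 1 then 1 else if even j \<and> i = j + 1 then - 1 else 0)"

definition Sp :: "nat \<Rightarrow> 'a::field mat monoid" where
  "Sp n = (GL (2 * n))\<lparr>carrier :=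
    {A \<in> carrier (GL (2 * n)). transpose_mat A * symplectic_gram n * A = symplectic_gram n}\<rparr>"

text \<open>A class is stabilized by \<open>a\<close> if \<open>\<omega> \<circ> (a \<times> a \<times> a)\<close> is cohomologous to \<open>\<omega>\<close> for each of its
  representatives \<open>\<omega>\<close>.\<close>

definition Stab :: "nat \<Rightarrow> (bit vec \<times> bit vec \<times> bit vec \<Rightarrow> 'k::field) set \<Rightarrow> bit mat monoid" where
  "Stab m c = (GL m)\<lparr>carrier :=
    {a \<in> carrier (GL m). \<forall>\<omega>\<in>c. pullback3 (V2 m) (\<lambda>v. a *\<^sub>v v) \<omega> \<in> c}\<rparr>"


section \<open>Classes of cubic polynomials\<close>

text \<open>Polynomials over \<open>\<F>\<^sub>2\<close> in the variables \<open>x\<^sub>0, x\<^sub>1, \<dots>\<close> are finitely supported functions from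
  exponent vectors to coefficients.\<close>

type_synonym bit_mpoly = "(nat \<Rightarrow>\<^sub>0 nat) \<Rightarrow>\<^sub>0 bit"

definition X :: "nat \<Rightarrow> bit_mpoly" where
  "X i = Poly_Mapping.single (Poly_Mapping.single i 1) 1"

text \<open>The isomorphism of \<open>\<S>\<^sup>3(x\<^sub>0, \<dots>, x\<^sub>m\<^sub>-\<^sub>1)\<close> with the third cohomology of \<open>\<F>\<^sub>2\<^sup>m\<close> with coefficients
  \<open>\<F>\<^sub>2\<close> on the level of cocycles: the monomial \<open>x\<^sub>a x\<^sub>b x\<^sub>c\<close> goes to the cup product
  \<open>(u, v, w) \<mapsto> u\<^sub>a v\<^sub>b w\<^sub>c\<close> of the coordinate functions. The factors are put in increasing
  order; the cohomology class does not depend on this choice.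
  Only meant for homogeneous polynomials of degree 3, other monomials are ignored.\<close>

definition cubic_cochain :: "nat \<Rightarrow> bit_mpoly \<Rightarrow> bit vec \<times> bit vec \<times> bit vec \<Rightarrow> bit" where
  "cubic_cochain m p = (\<lambda>(u, v, w).
    \<Sum>(a, b, c) \<in> {(a, b, c). a \<le> b \<and> b \<le> c \<and> c < m}.
      Poly_Mapping.lookup p
        (Poly_Mapping.single a 1 + Poly_Mapping.single b 1 + Poly_Mapping.single c 1)
      * (u $ a * v $ b * w $ c))"

definition sign_of_bit :: "bit \<Rightarrow> 'k::field" where
  "sign_of_bit b = (if b = 0 then 1 else - 1)"

definition cubic_cocycle :: "nat \<Rightarrow> bit_mpoly \<Rightarrow> (bit vec \<times> bit vec \<times> bit vec \<Rightarrow> 'k::field)" where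
  "cubic_cocycle m p =
    (\<lambda>t\<in>carrier (V2 m) \<times> carrier (V2 m) \<times> carrier (V2 m). sign_of_bit (cubic_cochain m p t))"

definition cubic_class ::
  "nat \<Rightarrow> bit_mpoly \<Rightarrow> (bit vec \<times> bit vec \<times> bit vec \<Rightarrow> 'k::field) set" where
  "cubic_class m p = cohomology_class (V2 m) field_units (cubic_cocycle m p)"

lemma sign_of_bit_add: "sign_of_bit (a + b) = (sign_of_bit a * sign_of_bit b :: 'k::field)"
  by (cases a; cases b) (simp_all add: sign_of_bit_def)

lemma cubic_cochain_cocycle:
  assumes "g \<in> carrier_vec m" "h \<in> carrier_vec m" "k \<in> carrier_vec m" "l \<in> carrier_vec m"
  shows "cubic_cochain m p (h, k, l) + cubic_cochain m p (g, h + k, l) + cubic_cochain m p (g, h, k)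
    = cubic_cochain m p (g + h, k, l) + cubic_cochain m p (g, h, k + l)"
  unfolding cubic_cochain_def prod.case sum.distrib[symmetric]
  by (intro sum.cong refl) (use assms in \<open>auto simp: algebra_simps\<close>)

lemma cubic_cocycle_in_cocycles3:
  "(cubic_cocycle m p :: _ \<Rightarrow> 'k::field) \<in> cocycles3 (V2 m) field_units"
proof -
  have units: "sign_of_bit b \<in> Units (class_ring :: 'k ring)" for b
    unfolding Units_def by (auto simp: sign_of_bit_def intro!: exI[of _ "- 1"])
  show ?thesis
    using cubic_cochain_cocycle[of _ m _ _ _ p] units
    by (auto simp: cocycles3_def cochains3_def cubic_cocycle_def monoid_vec_simps units_of_def
        sign_of_bit_add[symmetric] intro: restrict_PiE)
qed

lemma cubic_class_in_H3:
  "(cubic_class m p :: (_ \<Rightarrow> 'k::field) set) \<in> carrier (H3 (V2 m) field_units)"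
  using cubic_cocycle_in_cocycles3
  by (auto simp: cubic_class_def cohomology_class_def H3_def FactGroup_def RCOSETS_def r_coset_def)

end

theory Submission
  imports Defs
begin

text \<open>
  On the classes in \<open>H\<^sup>3(V, k\<^sup>\<times>)\<close> of cubic polynomials, cohomology is detected by restriction to
  cyclic subgroups: the class of \<open>p\<close> is determined by the function \<open>v \<mapsto> p(v)\<close> on \<open>V\<close>. Hence
  \<open>a\<close> stabilizes the class of \<open>x\<^sub>0 q\<close> if and only if it preserves the function \<open>x\<^sub>0 q\<close>, where \<open>q\<close> is a
  quadratic form on \<open>\<F>\<^sub>2\<^sup>2\<^sup>n\<close> that polarizes to the symplectic form. The square of the sum of
  \<open>(-1)\<^bsup>q(x)\<^esup>\<close> is \<open>2\<^sup>2\<^sup>n\<close>, also after adding a linear form to \<open>q\<close>. For \<open>n > 1\<close> it follows that \<open>q = 1\<close>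
  lies in no affine hyperplane, so that \<open>a\<close> preserves \<open>x\<^sub>0\<close> and acts on \<open>x\<^sub>0 = 1\<close> by an affine isometry
  \<open>x \<mapsto> A x + b\<close> of \<open>q\<close>. Its linear part is symplectic. Conversely, for symplectic \<open>A\<close> the map
  \<open>q \<circ> A + q\<close> is additive, hence represented by a unique \<open>b\<close>, and then \<open>q(A x + b) = q(x) + q(b)\<close>;
  since the sum of signs does not vanish, \<open>q(b) = 0\<close>.
\<close>

section \<open>Vectors over the field with two elements\<close>

text \<open>These library rules rewrite the field operations of \<open>\<F>\<^sub>2\<close> to bitwise operations, where
  \<open>algebra_simps\<close> and the ring lemmas no longer apply.\<close>

declare add_bit_eq_xor [simp del] mult_bit_eq_and [simp del] power_bit_unfold [simp del]
  minus_bit_def [simp del] uminus_bit_def [simp del] inverse_bit_def [simp del]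

lemma bit_add_self [simp]: "a + a = (0::bit)"
  by (cases a) simp_all

lemma bit_add_eq_0_iff: "a + b = 0 \<longleftrightarrow> a = (b::bit)"
  by (cases a; cases b) simp_all

lemma bit_square [simp]: "a * a = (a::bit)"
  by (cases a) simp_all

lemma bit_add_left_self [simp]: "a + (a + b) = (b::bit)"
  by (simp flip: add.assoc)

lemma sign_of_bit_0 [simp]: "sign_of_bit 0 = 1"
  and sign_of_bit_1 [simp]: "sign_of_bit 1 = - 1"
  by (simp_all add: sign_of_bit_def)

lemma bit_vec_add_self [simp]: "v \<in> carrier_vec m \<Longrightarrow> v + v = (0\<^sub>v m :: bit vec)"
  by (intro eq_vecI) auto

lemma bit_vec_add_left_self [simp]:
  "v \<in> carrier_vec m \<Longrightarrow> w \<in> carrier_vec m \<Longrightarrow> v + (v + w) = (w :: bit vec)"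
  by (simp flip: assoc_add_vec)

lemma carrier_vec_Suc_image: "carrier_vec (Suc m) = (\<lambda>(a, v). vCons a v) ` (UNIV \<times> carrier_vec m)"
proof (intro equalityI subsetI)
  fix w :: "'a vec" assume "w \<in> carrier_vec (Suc m)"
  then show "w \<in> (\<lambda>(a, v). vCons a v) ` (UNIV \<times> carrier_vec m)"
    by (cases w) auto
qed auto

lemma bit_carrier_vec_finite_card:
  "finite (carrier_vec m :: bit vec set) \<and> card (carrier_vec m :: bit vec set) = 2 ^ m"
proof (induction m)
  case 0
  have "(carrier_vec 0 :: bit vec set) = {0\<^sub>v 0}"
    by (auto intro: eq_vecI)
  then show ?case by simp
next
  case (Suc m)
  have U: "(UNIV :: bit set) = {0, 1}"
    using bit.exhaust by auto
  have "inj_on (\<lambda>(a, v). vCons a v) (UNIV \<times> carrier_vec m :: (bit \<times> bit vec) set)"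
    by (auto simp: inj_on_def)
  then show ?case
    using Suc by (simp add: carrier_vec_Suc_image card_image card_cartesian_product U)
qed

lemma finite_bit_carrier_vec [simp]: "finite (carrier_vec m :: bit vec set)"
  and card_bit_carrier_vec: "card (carrier_vec m :: bit vec set) = 2 ^ m"
  using bit_carrier_vec_finite_card by auto

lemma bit_additive_zero:
  fixes f :: "bit vec \<Rightarrow> bit"
  assumes "\<And>u v. u \<in> carrier_vec m \<Longrightarrow> v \<in> carrier_vec m \<Longrightarrow> f (u + v) = f u + f v"
  shows "f (0\<^sub>v m) = 0"
  using assms[of "0\<^sub>v m" "0\<^sub>v m"] by simp

text \<open>The only scalars are 0 and 1, so additivity alone gives linearity. The induction runs
  over the truncations \<open>p k\<close> of \<open>u\<close> to its first \<open>k\<close>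
  coordinates; consecutive truncations differ by at most one unit vector.\<close>

lemma bit_additive_expansion:
  fixes f :: "bit vec \<Rightarrow> bit"
  assumes add: "\<And>u v. u \<in> carrier_vec m \<Longrightarrow> v \<in> carrier_vec m \<Longrightarrow> f (u + v) = f u + f v"
    and u: "u \<in> carrier_vec m"
  shows "f u = (\<Sum>i<m. u $ i * f (unit_vec m i))"
proof -
  define p where "p k = vec m (\<lambda>i. if i < k then u $ i else 0)" for k
  have "k \<le> m \<Longrightarrow> f (p k) = (\<Sum>i<k. u $ i * f (unit_vec m i))" for k
  proof (induction k)
    case 0
    have "p 0 = 0\<^sub>v m"
      unfolding p_def by (intro eq_vecI) auto
    then show ?case
      using bit_additive_zero[of m f] add by simp
  next
    case (Suc k)
    have "p (Suc k) = p k + u $ k \<cdot>\<^sub>v unit_vec m k"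
      unfolding p_def using Suc.prems by (intro eq_vecI) (auto simp: unit_vec_def less_Suc_eq)
    then have "f (p (Suc k)) = f (p k) + f (u $ k \<cdot>\<^sub>v unit_vec m k)"
      using add[of "p k" "u $ k \<cdot>\<^sub>v unit_vec m k"] by (simp add: p_def)
    also have "f (u $ k \<cdot>\<^sub>v unit_vec m k) = u $ k * f (unit_vec m k)"
    proof (cases "u $ k = 0")
      case True
      have "(0::bit) \<cdot>\<^sub>v unit_vec m k = 0\<^sub>v m"
        by (intro eq_vecI) auto
      then show ?thesis using True bit_additive_zero[of m f] add by simp
    qed simp
    finally show ?case using Suc by simp
  qed
  moreover have "p m = u"
    unfolding p_def using u by (intro eq_vecI) auto
  ultimately show ?thesis by auto
qed

lemma mat_eq_if_mult_vec_eq: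
  fixes A B :: "'a::comm_ring_1 mat"
  assumes A: "A \<in> carrier_mat m n" and B: "B \<in> carrier_mat m n"
    and eq: "\<And>v. v \<in> carrier_vec n \<Longrightarrow> A *\<^sub>v v = B *\<^sub>v v"
  shows "A = B"
proof (rule eq_matI)
  fix i j assume "i < dim_row B" "j < dim_col B"
  moreover have "(A *\<^sub>v unit_vec n j) $ i = (B *\<^sub>v unit_vec n j) $ i"
    by (simp add: eq)
  ultimately show "A $$ (i, j) = B $$ (i, j)"
    using A B by (simp add: carrier_matD)
qed (use A B in auto)


section \<open>Nondegenerate quadratic forms over the field with two elements\<close>

text \<open>Reindexing along the permutation \<open>\<phi>\<close> changes the sign of every
  summand, so the sum equals its own negative.\<close>

lemma sum_sign_translate_zero:
  fixes f :: "bit vec \<Rightarrow> bit"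
  assumes "\<phi> ` carrier_vec m \<subseteq> carrier_vec m" and "inj_on \<phi> (carrier_vec m)"
    and "\<And>x. x \<in> carrier_vec m \<Longrightarrow> f (\<phi> x) = f x + 1"
  shows "(\<Sum>x\<in>carrier_vec m. sign_of_bit (f x) :: real) = 0"
proof -
  have "\<phi> ` carrier_vec m = carrier_vec m"
    using assms(1,2) by (simp add: endo_inj_surj)
  then have "(\<Sum>x\<in>carrier_vec m. sign_of_bit (f x) :: real) =
      (\<Sum>x\<in>carrier_vec m. sign_of_bit (f (\<phi> x)))"
    using sum.reindex[OF assms(2), of "\<lambda>x. sign_of_bit (f x) :: real"] by simp
  also have "\<dots> = - (\<Sum>x\<in>carrier_vec m. sign_of_bit (f x))"
    by (simp add: assms(3) sign_of_bit_add sum_negf)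
  finally show ?thesis by simp
qed

text \<open>Over F_2 a quadratic form is determined as such by its polarization rule. Taking
  \<open>J\<close> to be an involution makes the polar form nondegenerate and supplies explicit
  inverses, as in \<open>B_represents\<close> and \<open>symplectic_inverse\<close>.\<close>

locale bit_quadratic_form =
  fixes N :: nat and J :: "bit mat" and q :: "bit vec \<Rightarrow> bit"
  assumes J: "J \<in> carrier_mat N N" and J_J: "J * J = 1\<^sub>m N"
    and q_add: "\<And>x y. x \<in> carrier_vec N \<Longrightarrow> y \<in> carrier_vec N \<Longrightarrow>
      q (x + y) = q x + q y + x \<bullet> (J *\<^sub>v y)"
begin

definition B :: "bit vec \<Rightarrow> bit vec \<Rightarrow> bit" where
  "B x y = x \<bullet> (J *\<^sub>v y)"

lemma J_mult_vec [simp]: "y \<in> carrier_vec N \<Longrightarrow> J *\<^sub>v y \<in> carrier_vec N"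
  using J by simp

lemma J_J_vec [simp]: "y \<in> carrier_vec N \<Longrightarrow> J *\<^sub>v (J *\<^sub>v y) = y"
  using J J_J by (simp flip: assoc_mult_mat_vec)

lemma q_add_B: "x \<in> carrier_vec N \<Longrightarrow> y \<in> carrier_vec N \<Longrightarrow> q (x + y) = q x + q y + B x y"
  by (simp add: q_add B_def)

lemma B_add_left:
  "x \<in> carrier_vec N \<Longrightarrow> y \<in> carrier_vec N \<Longrightarrow> z \<in> carrier_vec N \<Longrightarrow> B (x + y) z = B x z + B y z"
  unfolding B_def by (rule add_scalar_prod_distrib) auto

lemma B_add_right:
  "x \<in> carrier_vec N \<Longrightarrow> y \<in> carrier_vec N \<Longrightarrow> z \<in> carrier_vec N \<Longrightarrow> B x (y + z) = B x y + B x z"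
  unfolding B_def using J by (simp add: mult_add_distrib_mat_vec scalar_prod_add_distrib[of _ N])

lemma B_zero_left [simp]: "z \<in> carrier_vec N \<Longrightarrow> B (0\<^sub>v N) z = 0"
  using B_add_left[of "0\<^sub>v N" "0\<^sub>v N" z] by simp

lemma B_zero_right [simp]: "z \<in> carrier_vec N \<Longrightarrow> B z (0\<^sub>v N) = 0"
  using B_add_right[of z "0\<^sub>v N" "0\<^sub>v N"] by simp

lemma q_zero [simp]: "q (0\<^sub>v N) = 0"
  using q_add_B[of "0\<^sub>v N" "0\<^sub>v N"] by (cases "q (0\<^sub>v N)") auto

lemma B_sym: "x \<in> carrier_vec N \<Longrightarrow> y \<in> carrier_vec N \<Longrightarrow> B x y = B y x"
  using q_add_B[of x y] q_add_B[of y x] by (simp add: comm_add_vec add.commute)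

lemma B_nondegenerate:
  assumes z: "z \<in> carrier_vec N" and "\<And>x. x \<in> carrier_vec N \<Longrightarrow> B x z = 0"
  shows "z = 0\<^sub>v N"
proof -
  have "J *\<^sub>v z = 0\<^sub>v N"
  proof (rule eq_vecI)
    fix i assume "i < dim_vec (0\<^sub>v N :: bit vec)"
    then show "(J *\<^sub>v z) $ i = 0\<^sub>v N $ i"
      using assms(2)[of "unit_vec N i"] z J by (simp add: B_def)
  qed (use J z in auto)
  then have "J *\<^sub>v (J *\<^sub>v z) = 0\<^sub>v N"
    using J by auto
  then show ?thesis using z by simp
qed

text \<open>Since \<open>J\<close> is an involution, pairing \<open>x\<close> with
  \<open>J *\<^sub>v m\<close> under \<open>B\<close> is the dot product of \<open>x\<close> and
  \<open>m\<close>; the values of \<open>\<mu>\<close> on unit vectors serve as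
  \<open>m\<close>.\<close>

lemma B_represents:
  fixes \<mu> :: "bit vec \<Rightarrow> bit"
  assumes add: "\<And>u v. u \<in> carrier_vec N \<Longrightarrow> v \<in> carrier_vec N \<Longrightarrow> \<mu> (u + v) = \<mu> u + \<mu> v"
  obtains b where "b \<in> carrier_vec N" "\<And>x. x \<in> carrier_vec N \<Longrightarrow> \<mu> x = B x b"
proof
  let ?m = "vec N (\<lambda>i. \<mu> (unit_vec N i))"
  show "J *\<^sub>v ?m \<in> carrier_vec N" by simp
  show "\<mu> x = B x (J *\<^sub>v ?m)" if "x \<in> carrier_vec N" for x
    using bit_additive_expansion[OF add that] that
    by (simp add: B_def scalar_prod_def lessThan_atLeast0)
qed

section \<open>Character sums and Gauss sums\<close>

lemma sum_sign_B:
  assumes z: "z \<in> carrier_vec N"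
  shows "(\<Sum>x\<in>carrier_vec N. sign_of_bit (B x z) :: real) = (if z = 0\<^sub>v N then 2 ^ N else 0)"
proof (cases "z = 0\<^sub>v N")
  case True
  then show ?thesis by (simp add: sign_of_bit_def card_bit_carrier_vec)
next
  case False
  then obtain w where w: "w \<in> carrier_vec N" "B w z = 1"
    using B_nondegenerate[OF z] bit_not_zero_iff by blast
  \<comment> \<open>Translation by \<open>w\<close> raises the exponent \<open>B x z\<close> by 1,
    so this nontrivial character sums to zero.\<close>
  have "inj_on (\<lambda>x. w + x) (carrier_vec N)"
    using w(1) by (metis bit_vec_add_left_self inj_onI)
  then show ?thesis
    using False w z by (subst sum_sign_translate_zero[of "\<lambda>x. w + x"]) (auto simp: B_add_left add.commute)
qed

text \<open>In the double sum put y = x + z. Then q(x) + q(y) = q(z) + B(x, z), and summing over x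
  first leaves only z = 0 by orthogonality of characters.\<close>

lemma gauss_sum_square: "(\<Sum>x\<in>carrier_vec N. sign_of_bit (q x) :: real)\<^sup>2 = 2 ^ N"
proof -
  let ?V = "carrier_vec N :: bit vec set" and ?s = "sign_of_bit :: bit \<Rightarrow> real"
  have reindex: "(\<Sum>y\<in>?V. ?s (q y)) = (\<Sum>z\<in>?V. ?s (q (x + z)))" if "x \<in> ?V" for x
    by (rule sum.reindex_bij_witness[of _ "\<lambda>z. x + z" "\<lambda>y. x + y"]) (use that in auto)
  have "(\<Sum>x\<in>?V. ?s (q x))\<^sup>2 = (\<Sum>x\<in>?V. \<Sum>y\<in>?V. ?s (q x) * ?s (q y))"
    by (simp add: power2_eq_square sum_product)
  also have "\<dots> = (\<Sum>x\<in>?V. \<Sum>z\<in>?V. ?s (q x) * ?s (q (x + z)))"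
    using reindex by (simp flip: sum_distrib_left)
  also have "\<dots> = (\<Sum>x\<in>?V. \<Sum>z\<in>?V. ?s (q z) * ?s (B x z))"
    by (intro sum.cong refl) (simp add: q_add_B add.assoc flip: sign_of_bit_add)
  also have "\<dots> = (\<Sum>z\<in>?V. ?s (q z) * (\<Sum>x\<in>?V. ?s (B x z)))"
    by (subst sum.swap) (simp add: sum_distrib_left)
  also have "\<dots> = (\<Sum>z\<in>?V. if z = 0\<^sub>v N then 2 ^ N else 0)"
    by (intro sum.cong refl) (auto simp: sum_sign_B)
  also have "\<dots> = 2 ^ N" by simp
  finally show ?thesis .
qed

text \<open>The polar form is unchanged, so \<open>gauss_sum_square\<close> applies to the twisted
  form as well.\<close>

lemma quadratic_form_add_B:
  assumes c: "c \<in> carrier_vec N"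
  shows "bit_quadratic_form N J (\<lambda>x. q x + B x c)"
  by unfold_locales (use c J J_J in \<open>auto simp: q_add_B B_add_left B_def[symmetric] ac_simps\<close>)

lemma q_offset_eq_0:
  assumes \<phi>: "\<And>x. x \<in> carrier_vec N \<Longrightarrow> \<phi> x \<in> carrier_vec N" "inj_on \<phi> (carrier_vec N)"
    and "\<And>x. x \<in> carrier_vec N \<Longrightarrow> q (\<phi> x) = q x + d"
  shows "d = 0"
proof (rule ccontr)
  assume "d \<noteq> 0"
  then have "(\<Sum>x\<in>carrier_vec N. sign_of_bit (q x) :: real) = 0"
    using assms by (intro sum_sign_translate_zero[of \<phi>]) auto
  then show False using gauss_sum_square by simp
qed

text \<open>The product of 1 - (-1)^q(x) and 1 - (-1)^(B(x,c)+d) vanishes for all x. Its sum over x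
  compares 2^N with two Gauss sums of absolute value 2^(N/2), which forces N <= 2. The bound is
  sharp: the form x_1 x_2 takes the value 1 at a single point.\<close>

lemma affine_vanishing_on_quadric:
  assumes N: "N > 2" and c: "c \<in> carrier_vec N"
    and van: "\<And>x. x \<in> carrier_vec N \<Longrightarrow> q x = 1 \<Longrightarrow> B x c = d"
  shows "c = 0\<^sub>v N \<and> d = 0"
proof (rule ccontr)
  assume neg: "\<not> ?thesis"
  let ?V = "carrier_vec N :: bit vec set" and ?s = "sign_of_bit :: bit \<Rightarrow> real"
  interpret T: bit_quadratic_form N J "\<lambda>x. q x + B x c" by (rule quadratic_form_add_B[OF c])
  let ?S = "\<Sum>x\<in>?V. ?s (q x)" and ?T = "\<Sum>x\<in>?V. ?s (q x + B x c)"
  have "(\<Sum>x\<in>?V. (1 - ?s (q x)) * (1 - ?s (B x c + d))) = 0"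
    using van by (intro sum.neutral) (auto simp: sign_of_bit_def)
  moreover have "(1 - ?s (q x)) * (1 - ?s (B x c + d)) =
      1 - ?s (q x) - ?s d * ?s (B x c) + ?s d * ?s (q x + B x c)" for x
    by (simp add: sign_of_bit_add algebra_simps)
  ultimately have eq: "2 ^ N - ?S - ?s d * (\<Sum>x\<in>?V. ?s (B x c)) + ?s d * ?T = 0"
    by (simp add: sum.distrib sum_subtractf card_bit_carrier_vec flip: sum_distrib_left)
  \<comment> \<open>For nonzero \<open>c\<close> the character sum is 0; for zero \<open>c\<close>
    the assumption forces d = 1, and the term is -2^N.\<close>
  have "?s d * (\<Sum>x\<in>?V. ?s (B x c)) \<le> 0"
    using neg by (cases d) (auto simp: sum_sign_B[OF c])
  moreover have "\<bar>?s d * ?T\<bar> = \<bar>?T\<bar>" by (simp add: sign_of_bit_def)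
  ultimately have "2 ^ N \<le> \<bar>?S\<bar> + \<bar>?T\<bar>" using eq by linarith
  then have "(2 ^ N)\<^sup>2 \<le> (\<bar>?S\<bar> + \<bar>?T\<bar>)\<^sup>2" by (intro power_mono) auto
  also have "\<dots> \<le> 2 * ?S\<^sup>2 + 2 * ?T\<^sup>2"
    using zero_le_power2[of "\<bar>?S\<bar> - \<bar>?T\<bar>"] by (simp add: power2_sum power2_diff)
  also have "\<dots> = 4 * 2 ^ N"
    using gauss_sum_square T.gauss_sum_square by simp
  finally have "(2::real) ^ N \<le> 2 ^ 2" by (simp add: power2_eq_square)
  then have "N \<le> 2" by (subst (asm) power_increasing_iff) auto
  then show False using N by simp
qed

end


section \<open>Affine isometries of a quadratic form\<close>

lemma carrier_GL_iff:
  "M \<in> carrier (GL m :: 'a::field mat monoid) \<longleftrightarrow>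
    M \<in> carrier_mat m m \<and> (\<exists>M'\<in>carrier_mat m m. M' * M = 1\<^sub>m m)"
  by (auto simp: GL_def units_of_def Units_def ring_mat_simps dest: mat_mult_left_right_inverse)

lemma mult_GL [simp]: "mult (GL m) = (*)"
  by (simp add: GL_def units_of_def ring_mat_simps)

definition homogenize :: "nat \<Rightarrow> (bit vec \<Rightarrow> bit) \<Rightarrow> bit vec \<Rightarrow> bit" where
  "homogenize N q v = v $ 0 * q (vec N (\<lambda>i. v $ Suc i))"

lemma homogenize_vCons [simp]: "x \<in> carrier_vec N \<Longrightarrow> homogenize N q (vCons t x) = t * q x"
proof -
  assume "x \<in> carrier_vec N"
  then have "vec N (\<lambda>i. x $ i) = x" by (intro eq_vecI) auto
  then show ?thesis by (simp add: homogenize_def)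
qed

text \<open>The matrix of \<open>(t, x) \<mapsto> (t, t b + A x)\<close>, that is, of the affine map \<open>x \<mapsto> A x + b\<close>
  of the hyperplane \<open>t = 1\<close>.\<close>

definition affine_mat :: "nat \<Rightarrow> 'a::field vec \<Rightarrow> 'a mat \<Rightarrow> 'a mat" where
  "affine_mat N b A = mat (Suc N) (Suc N) (\<lambda>(i, j).
    case i of 0 \<Rightarrow> if j = 0 then 1 else 0
    | Suc i' \<Rightarrow> (case j of 0 \<Rightarrow> b $ i' | Suc j' \<Rightarrow> A $$ (i', j')))"

definition linear_part :: "nat \<Rightarrow> 'a mat \<Rightarrow> 'a mat" where
  "linear_part N M = mat N N (\<lambda>(i, j). M $$ (Suc i, Suc j))"

lemma affine_mat_carrier [simp]: "affine_mat N b A \<in> carrier_mat (Suc N) (Suc N)"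
  by (simp add: affine_mat_def)

lemma affine_mat_mult_vCons:
  assumes "b \<in> carrier_vec N" "A \<in> carrier_mat N N" "x \<in> carrier_vec N"
  shows "affine_mat N b A *\<^sub>v vCons t x = vCons t (t \<cdot>\<^sub>v b + A *\<^sub>v x)"
proof (rule eq_vecI)
  fix i assume "i < dim_vec (vCons t (t \<cdot>\<^sub>v b + A *\<^sub>v x))"
  then have i: "i < Suc N" using assms by simp
  show "(affine_mat N b A *\<^sub>v vCons t x) $ i = vCons t (t \<cdot>\<^sub>v b + A *\<^sub>v x) $ i"
    using i assms
    by (cases i) (auto simp: affine_mat_def scalar_prod_def sum.atLeast0_lessThan_Suc_shift
        simp del: sum.op_ivl_Suc intro: sum.neutral)
qed (use assms in \<open>auto simp: affine_mat_def\<close>)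

lemma linear_part_affine_mat [simp]:
  "A \<in> carrier_mat N N \<Longrightarrow> linear_part N (affine_mat N b A) = A"
  by (intro eq_matI) (auto simp: linear_part_def affine_mat_def)

lemma linear_part_carrier [simp]: "linear_part N M \<in> carrier_mat N N"
  by (simp add: linear_part_def)

lemma affine_mat_of_row_0:
  assumes M: "M \<in> carrier_mat (Suc N) (Suc N)"
    and "M $$ (0, 0) = 1" "\<And>j. j < N \<Longrightarrow> M $$ (0, Suc j) = 0"
  shows "M = affine_mat N (vec N (\<lambda>i. M $$ (Suc i, 0))) (linear_part N M)"
  using assms
  by (intro eq_matI) (auto simp: affine_mat_def linear_part_def gr0_conv_Suc split: nat.split)

text \<open>Composition of affine maps; this is what makes \<open>linear_part\<close> multiplicative
  on the stabilizer.\<close>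

lemma affine_mat_mult:
  assumes "b \<in> carrier_vec N" "A \<in> carrier_mat N N" "b' \<in> carrier_vec N" "A' \<in> carrier_mat N N"
  shows "affine_mat N b A * affine_mat N b' A' = affine_mat N (b + A *\<^sub>v b') (A * A')"
proof (rule mat_eq_if_mult_vec_eq[of _ "Suc N" "Suc N"])
  fix v :: "'a vec" assume "v \<in> carrier_vec (Suc N)"
  then obtain t x where v: "v = vCons t x" and x: "x \<in> carrier_vec N"
    unfolding carrier_vec_Suc_image by auto
  have "A *\<^sub>v (t \<cdot>\<^sub>v b' + A' *\<^sub>v x) = t \<cdot>\<^sub>v (A *\<^sub>v b') + A * A' *\<^sub>v x"
    using assms x by (simp add: mult_add_distrib_mat_vec mult_mat_vec[of A N N])
  then show "affine_mat N b A * affine_mat N b' A' *\<^sub>v v = affine_mat N (b + A *\<^sub>v b') (A * A') *\<^sub>v v"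
    using assms x unfolding v
    by (simp add: assoc_mult_mat_vec[of _ "Suc N" "Suc N" _ "Suc N"] affine_mat_mult_vCons
        smult_add_distrib_vec[of _ N] assoc_add_vec[of _ N])
qed (auto intro: mult_carrier_mat[of _ _ "Suc N"])

lemma affine_mat_zero_one: "affine_mat N (0\<^sub>v N) (1\<^sub>m N) = 1\<^sub>m (Suc N)"
  by (intro eq_matI) (auto simp: affine_mat_def split: nat.split)

text \<open>Multiplying by an affine matrix on the left keeps row 0, so an inverse \<open>M'\<close>
  has the row 0 of the identity and is itself affine; its linear part inverts \<open>A\<close>.
  Conversely, the affine map with linear part \<open>C\<close> and translation -Cb inverts the given
  one when \<open>C\<close> inverts \<open>A\<close>.\<close>

lemma affine_mat_in_GL_iff:
  assumes b: "b \<in> carrier_vec N" and A: "A \<in> carrier_mat N N"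
  shows "affine_mat N b A \<in> carrier (GL (Suc N)) \<longleftrightarrow> A \<in> carrier (GL N)"
proof
  assume "affine_mat N b A \<in> carrier (GL (Suc N))"
  then obtain M' where M': "M' \<in> carrier_mat (Suc N) (Suc N)" "M' * affine_mat N b A = 1\<^sub>m (Suc N)"
    by (auto simp: carrier_GL_iff)
  then have R: "affine_mat N b A * M' = 1\<^sub>m (Suc N)"
    by (auto intro: mat_mult_left_right_inverse)
  have "M' $$ (0, j) = (1\<^sub>m (Suc N) :: 'a mat) $$ (0, j)" if "j < Suc N" for j
  proof -
    have "(affine_mat N b A * M') $$ (0, j) = M' $$ (0, j)"
      using that M'(1)
      by (auto simp: affine_mat_def scalar_prod_def sum.atLeast0_lessThan_Suc_shift
          simp del: sum.op_ivl_Suc intro: sum.neutral)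
    then show ?thesis by (simp only: R)
  qed
  then have "M' = affine_mat N (vec N (\<lambda>i. M' $$ (Suc i, 0))) (linear_part N M')"
    using M'(1) by (intro affine_mat_of_row_0) auto
  then obtain b' where "M' = affine_mat N b' (linear_part N M')" and b': "b' \<in> carrier_vec N"
    by (metis vec_carrier)
  then have "affine_mat N (b' + linear_part N M' *\<^sub>v b) (linear_part N M' * A) = 1\<^sub>m (Suc N)"
    using M'(2) affine_mat_mult[OF b' linear_part_carrier b A] by metis
  then have "linear_part N M' * A = linear_part N (1\<^sub>m (Suc N))"
    using A by (metis linear_part_affine_mat linear_part_carrier mult_carrier_mat)
  also have "\<dots> = 1\<^sub>m N"
    by (intro eq_matI) (auto simp: linear_part_def)
  finally show "A \<in> carrier (GL N)"
    using A by (auto simp: carrier_GL_iff intro!: bexI[of _ "linear_part N M'"])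
next
  assume "A \<in> carrier (GL N)"
  then obtain C where C: "C \<in> carrier_mat N N" "C * A = 1\<^sub>m N"
    by (auto simp: carrier_GL_iff)
  have "affine_mat N (- (C *\<^sub>v b)) C * affine_mat N b A = 1\<^sub>m (Suc N)"
    using C b A by (subst affine_mat_mult) (auto simp: affine_mat_zero_one uminus_l_inv_vec[of _ N])
  then show "affine_mat N b A \<in> carrier (GL (Suc N))"
    by (auto simp: carrier_GL_iff)
qed

section \<open>Symplectic matrices, affine isometries and the stabilizer of x_0 q\<close>

context bit_quadratic_form
begin

lemma B_congruence:
  assumes A: "A \<in> carrier_mat N N" and "x \<in> carrier_vec N" "y \<in> carrier_vec N"
  shows "x \<bullet> ((transpose_mat A * J * A) *\<^sub>v y) = B (A *\<^sub>v x) (A *\<^sub>v y)"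
proof -
  have "(transpose_mat A * J * A) *\<^sub>v y = transpose_mat A *\<^sub>v (J *\<^sub>v (A *\<^sub>v y))"
    using assms J by (simp add: assoc_mult_mat_vec[of _ N N _ N])
  moreover have "x \<bullet> (transpose_mat A *\<^sub>v (J *\<^sub>v (A *\<^sub>v y))) = (A *\<^sub>v x) \<bullet> (J *\<^sub>v (A *\<^sub>v y))"
    using assms by (subst (1 2) comm_scalar_prod[of _ N])
      (auto simp: transpose_vec_mult_scalar[OF A])
  ultimately show ?thesis by (simp add: B_def)
qed

lemma symplectic_iff:
  assumes A: "A \<in> carrier_mat N N"
  shows "transpose_mat A * J * A = J \<longleftrightarrow>
    (\<forall>x\<in>carrier_vec N. \<forall>y\<in>carrier_vec N. B (A *\<^sub>v x) (A *\<^sub>v y) = B x y)"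
proof
  assume "transpose_mat A * J * A = J"
  then show "\<forall>x\<in>carrier_vec N. \<forall>y\<in>carrier_vec N. B (A *\<^sub>v x) (A *\<^sub>v y) = B x y"
    using B_congruence[OF A] by (simp add: B_def)
next
  assume *: "\<forall>x\<in>carrier_vec N. \<forall>y\<in>carrier_vec N. B (A *\<^sub>v x) (A *\<^sub>v y) = B x y"
  show "transpose_mat A * J * A = J"
  proof (rule mat_eq_if_mult_vec_eq)
    fix y :: "bit vec" assume y: "y \<in> carrier_vec N"
    show "(transpose_mat A * J * A) *\<^sub>v y = J *\<^sub>v y"
    proof (rule eq_vecI)
      fix i assume "i < dim_vec (J *\<^sub>v y)"
      then have i: "i < N" using J by simp
      have "unit_vec N i \<bullet> ((transpose_mat A * J * A) *\<^sub>v y) = unit_vec N i \<bullet> (J *\<^sub>v y)"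
        using * y B_congruence[OF A] by (simp add: B_def)
      moreover have "(transpose_mat A * J * A) *\<^sub>v y \<in> carrier_vec N" "J *\<^sub>v y \<in> carrier_vec N"
        using A J y by (auto intro!: mult_mat_vec_carrier[of _ N N] mult_carrier_mat[of _ N N _ N])
      ultimately show "((transpose_mat A * J * A) *\<^sub>v y) $ i = (J *\<^sub>v y) $ i"
        using i by (metis scalar_prod_left_unit)
    qed (use A J in auto)
  qed (use A J in auto)
qed

text \<open>Multiplying the symplectic condition by \<open>J\<close> from the left turns its right
  side into the identity, which exhibits the inverse J A^T J.\<close>

lemma symplectic_inverse:
  assumes A: "A \<in> carrier_mat N N" and "transpose_mat A * J * A = J"
  obtains C where "C \<in> carrier_mat N N" "C * A = 1\<^sub>m N" "A * C = 1\<^sub>m N"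
proof
  let ?C = "J * (transpose_mat A * J)"
  show C: "?C \<in> carrier_mat N N" using A J by auto
  have "?C * A = J * (transpose_mat A * J * A)"
    using A J by (intro assoc_mult_mat) auto
  then show "?C * A = 1\<^sub>m N" by (simp add: assms(2) J_J)
  then show "A * ?C = 1\<^sub>m N" using mat_mult_left_right_inverse[OF C A] by simp
qed

text \<open>Invertibility of \<open>A\<close> is not demanded; it follows from
  \<open>affine_isometry_symplectic\<close> and \<open>symplectic_inverse\<close>.\<close>

definition affine_isometry :: "bit vec \<Rightarrow> bit mat \<Rightarrow> bool" where
  "affine_isometry b A \<longleftrightarrow> b \<in> carrier_vec N \<and> A \<in> carrier_mat N N \<and>
    (\<forall>x\<in>carrier_vec N. q (b + A *\<^sub>v x) = q x)"

lemma affine_isometry_q_translation: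
  assumes "affine_isometry b A"
  shows "q b = 0"
proof -
  have "b \<in> carrier_vec N" "A *\<^sub>v 0\<^sub>v N = 0\<^sub>v N" "q (b + A *\<^sub>v 0\<^sub>v N) = q (0\<^sub>v N)"
    using assms by (auto simp: affine_isometry_def)
  then show ?thesis by simp
qed

text \<open>\<open>B\<close> is recovered from \<open>q\<close> by polarization. In the resulting
  three terms the translation drops out, because q(b) = 0 and pairing with \<open>b\<close> is
  additive.\<close>

lemma affine_isometry_symplectic:
  assumes iso: "affine_isometry b A"
  shows "transpose_mat A * J * A = J"
proof -
  have b: "b \<in> carrier_vec N" and A: "A \<in> carrier_mat N N"
    and inv: "\<And>x. x \<in> carrier_vec N \<Longrightarrow> q x = q (b + A *\<^sub>v x)"
    using iso by (auto simp: affine_isometry_def)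
  have "B (A *\<^sub>v x) (A *\<^sub>v y) = B x y" if xy: "x \<in> carrier_vec N" "y \<in> carrier_vec N" for x y
  proof -
    have "B x y = q (x + y) + q x + q y"
      using xy by (simp add: q_add_B ac_simps)
    also have "\<dots> = q (b + A *\<^sub>v (x + y)) + q (b + A *\<^sub>v x) + q (b + A *\<^sub>v y)"
      using xy inv by simp
    also have "\<dots> = B (A *\<^sub>v x) (A *\<^sub>v y)"
      using xy A b affine_isometry_q_translation[OF iso]
      by (simp add: q_add_B B_add_right mult_add_distrib_mat_vec[OF A] ac_simps)
    finally show ?thesis by simp
  qed
  then show ?thesis using symplectic_iff[OF A] by simp
qed

text \<open>As \<open>A\<close> is surjective, q(b + y) = q(b' + y) for every y. Expanding shows
  that b + b' is orthogonal to everything.\<close>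

lemma affine_isometry_unique:
  assumes 1: "affine_isometry b A" and 2: "affine_isometry b' A"
  shows "b = b'"
proof -
  have b: "b \<in> carrier_vec N" "b' \<in> carrier_vec N" and A: "A \<in> carrier_mat N N"
    using assms by (auto simp: affine_isometry_def)
  obtain C where C: "C \<in> carrier_mat N N" "A * C = 1\<^sub>m N"
    using symplectic_inverse[OF A affine_isometry_symplectic[OF 1]] by blast
  have "B y (b + b') = 0" if y: "y \<in> carrier_vec N" for y
  proof -
    have Cy: "C *\<^sub>v y \<in> carrier_vec N" "A *\<^sub>v (C *\<^sub>v y) = y"
      using A C y by (auto simp flip: assoc_mult_mat_vec[of A N N C N])
    then have "q (b + y) = q (b' + y)"
      using 1 2 unfolding affine_isometry_def by metis
    then show ?thesis
      using b y affine_isometry_q_translation[OF 1] affine_isometry_q_translation[OF 2]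
      by (simp add: q_add_B B_add_right B_sym[of y])
  qed
  then have "b + b' = 0\<^sub>v N"
    using b by (intro B_nondegenerate) auto
  then have "b + (b + b') = b" using b by simp
  then show ?thesis using b by simp
qed

lemma affine_isometry_exists:
  assumes A: "A \<in> carrier_mat N N" and symp: "transpose_mat A * J * A = J"
  obtains b where "affine_isometry b A"
proof -
  obtain C where C: "C \<in> carrier_mat N N" "C * A = 1\<^sub>m N"
    using symplectic_inverse[OF A symp] by blast
  have CA: "C *\<^sub>v (A *\<^sub>v x) = x" if "x \<in> carrier_vec N" for x
    using A C that by (simp flip: assoc_mult_mat_vec[of C N N A N])
  have B_A: "B (A *\<^sub>v x) (A *\<^sub>v y) = B x y" if "x \<in> carrier_vec N" "y \<in> carrier_vec N" for x y
    using symp symplectic_iff[OF A] that by simp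
  define \<mu> where "\<mu> x = q (A *\<^sub>v x) + q x" for x
  have \<mu>_add: "\<mu> (x + y) = \<mu> x + \<mu> y" if "x \<in> carrier_vec N" "y \<in> carrier_vec N" for x y
    using that A B_A[OF that] by (simp add: \<mu>_def q_add_B mult_add_distrib_mat_vec[OF A] ac_simps)
  \<comment> \<open>The representing vector has to pair with \<open>A *\<^sub>v x\<close> rather
    than with \<open>x\<close>, hence the composition of \<open>\<mu>\<close> with the inverse
    \<open>C\<close>.\<close>
  have "\<mu> (C *\<^sub>v (u + v)) = \<mu> (C *\<^sub>v u) + \<mu> (C *\<^sub>v v)"
    if "u \<in> carrier_vec N" "v \<in> carrier_vec N" for u v
    using that C by (simp add: mult_add_distrib_mat_vec[OF C(1)] \<mu>_add)
  then obtain b where b: "b \<in> carrier_vec N"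
    and rep: "\<And>y. y \<in> carrier_vec N \<Longrightarrow> \<mu> (C *\<^sub>v y) = B y b"
    using B_represents[of "\<lambda>y. \<mu> (C *\<^sub>v y)"] by blast
  have q_b: "q (b + A *\<^sub>v x) = q x + q b" if x: "x \<in> carrier_vec N" for x
  proof -
    have "B (A *\<^sub>v x) b = q (A *\<^sub>v x) + q x"
      using rep[of "A *\<^sub>v x"] A CA x by (simp add: \<mu>_def)
    then show ?thesis
      using A b x by (simp add: q_add_B B_sym[of b] ac_simps)
  qed
  have "q b = 0"
  proof (rule q_offset_eq_0)
    show "inj_on (\<lambda>x. b + A *\<^sub>v x) (carrier_vec N)"
    proof (rule inj_onI)
      fix x y assume xy: "x \<in> carrier_vec N" "y \<in> carrier_vec N" "b + A *\<^sub>v x = b + A *\<^sub>v y"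
      moreover have "A *\<^sub>v x \<in> carrier_vec N" "A *\<^sub>v y \<in> carrier_vec N" using A xy by auto
      ultimately have "A *\<^sub>v x = A *\<^sub>v y" using b by (metis bit_vec_add_left_self)
      then show "x = y" using CA xy by metis
    qed
  qed (use A b q_b in auto)
  then have "affine_isometry b A"
    using A b q_b by (simp add: affine_isometry_def)
  then show thesis by (rule that)
qed

definition stabilizer :: "bit mat set" where
  "stabilizer = {M \<in> carrier (GL (Suc N)).
    \<forall>v\<in>carrier_vec (Suc N). homogenize N q (M *\<^sub>v v) = homogenize N q v}"

lemma affine_mat_in_stabilizer_iff:
  assumes b: "b \<in> carrier_vec N" and A: "A \<in> carrier_mat N N"
  shows "affine_mat N b A \<in> stabilizer \<longleftrightarrow> affine_isometry b A"
proof -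
  have "homogenize N q (affine_mat N b A *\<^sub>v vCons t x) = t * q (b + A *\<^sub>v x)"
    if "x \<in> carrier_vec N" for t x
    using that A b by (cases t) (auto simp: affine_mat_mult_vCons)
  then have "(\<forall>v\<in>carrier_vec (Suc N).
      homogenize N q (affine_mat N b A *\<^sub>v v) = homogenize N q v) \<longleftrightarrow> affine_isometry b A"
    using assms by (force simp: carrier_vec_Suc_image affine_isometry_def)
  moreover have "A \<in> carrier (GL N)" if "affine_isometry b A"
    using symplectic_inverse[OF A affine_isometry_symplectic[OF that]] A
    by (auto simp: carrier_GL_iff)
  ultimately show ?thesis
    using affine_mat_in_GL_iff[OF assms] by (auto simp: stabilizer_def)
qed

text \<open>The homogenization is nonzero exactly at the points \<open>(1, x)\<close> with \<open>q x = 1\<close>. These span the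
  hyperplane \<open>t = 1\<close> affinely, so the coordinate \<open>t\<close> is preserved.\<close>

lemma stabilizer_affine:
  assumes N: "N > 2" and M: "M \<in> stabilizer"
  obtains b A where "M = affine_mat N b A" "affine_isometry b A"
proof -
  have M_carrier: "M \<in> carrier_mat (Suc N) (Suc N)"
    using M by (simp add: stabilizer_def carrier_GL_iff)
  define f where "f v = (M *\<^sub>v v) $ 0" for v
  have f_add: "f (u + v) = f u + f v" if "u \<in> carrier_vec (Suc N)" "v \<in> carrier_vec (Suc N)" for u v
    using that M_carrier by (simp add: f_def mult_add_distrib_mat_vec[OF M_carrier] del: index_mult_mat_vec)
  have vCons_add: "vCons s x + vCons t y = vCons (s + t) (x + y)"
    if "x \<in> carrier_vec N" "y \<in> carrier_vec N" for s t :: bit and x y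
    using that by (intro eq_vecI) (auto simp: vec_index_vCons)
  have "f (vCons 0 (x + y)) = f (vCons 0 x) + f (vCons 0 y)"
    if "x \<in> carrier_vec N" "y \<in> carrier_vec N" for x y
    using f_add[of "vCons 0 x" "vCons 0 y"] vCons_add[OF that] that by simp
  then obtain c where c: "c \<in> carrier_vec N"
    and f_0: "\<And>x. x \<in> carrier_vec N \<Longrightarrow> f (vCons 0 x) = B x c"
    using B_represents[of "\<lambda>x. f (vCons 0 x)"] by blast
  \<comment> \<open>The summand 1 turns the condition that \<open>f\<close> is 1 at (1, x) into
    \<open>B x c = d\<close>, the hypothesis of \<open>affine_vanishing_on_quadric\<close>.\<close>
  define d where "d = f (vCons 1 (0\<^sub>v N)) + 1"
  have f_1: "f (vCons 1 x) = B x c + d + 1" if "x \<in> carrier_vec N" for x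
    using f_add[of "vCons 0 x" "vCons 1 (0\<^sub>v N)"] vCons_add[of x "0\<^sub>v N" 0 1] that
    by (simp add: d_def f_0 add.assoc)
  have "B x c = d" if x: "x \<in> carrier_vec N" "q x = 1" for x
  proof -
    have "homogenize N q (M *\<^sub>v vCons 1 x) = 1"
      using M x by (simp add: stabilizer_def)
    then have "f (vCons 1 x) = 1"
      by (cases "f (vCons 1 x)") (auto simp: homogenize_def f_def)
    then show ?thesis using f_1 x by (simp add: bit_add_eq_0_iff)
  qed
  then have cd: "c = 0\<^sub>v N" "d = 0"
    using affine_vanishing_on_quadric[OF N c] by auto
  have "M $$ (0, j) = f (unit_vec (Suc N) j)" if "j < Suc N" for j
    using M_carrier that by (simp add: f_def)
  moreover have "unit_vec (Suc N) 0 = vCons (1::bit) (0\<^sub>v N)"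
    and "j < N \<Longrightarrow> unit_vec (Suc N) (Suc j) = vCons (0::bit) (unit_vec N j)" for j
    by (auto intro!: eq_vecI simp: vec_index_vCons unit_vec_def)
  ultimately have row: "M $$ (0, 0) = 1" "\<And>j. j < N \<Longrightarrow> M $$ (0, Suc j) = 0"
    using f_0 f_1[of "0\<^sub>v N"] cd by auto
  have eq: "M = affine_mat N (vec N (\<lambda>i. M $$ (Suc i, 0))) (linear_part N M)"
    by (rule affine_mat_of_row_0[OF M_carrier row])
  have "affine_isometry (vec N (\<lambda>i. M $$ (Suc i, 0))) (linear_part N M)"
    using M eq by (subst affine_mat_in_stabilizer_iff[symmetric]) auto
  then show thesis using eq that by blast
qed

text \<open>Bijectivity amounts to existence and uniqueness of the translation \<open>b\<close>
  belonging to a symplectic \<open>A\<close>.\<close>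

lemma linear_part_iso:
  assumes N: "N > 2"
  shows "linear_part N \<in> iso ((GL (Suc N))\<lparr>carrier := stabilizer\<rparr>)
    ((GL N)\<lparr>carrier := {A \<in> carrier (GL N). transpose_mat A * J * A = J}\<rparr>)"
proof -
  let ?Sp = "{A \<in> carrier (GL N). transpose_mat A * J * A = J}"
  have lin: "linear_part N M \<in> ?Sp" if M: "M \<in> stabilizer" for M
  proof -
    obtain b A where M': "M = affine_mat N b A" and iso: "affine_isometry b A"
      using stabilizer_affine[OF N M] .
    then have "b \<in> carrier_vec N" and A: "A \<in> carrier_mat N N" by (auto simp: affine_isometry_def)
    then have "A \<in> carrier (GL N)"
      using M affine_mat_in_GL_iff[of b N A] by (simp add: M' stabilizer_def)
    then show ?thesis using A affine_isometry_symplectic[OF iso] by (simp add: M')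
  qed
  have "linear_part N (M * M') = linear_part N M * linear_part N M'"
    if MM': "M \<in> stabilizer" "M' \<in> stabilizer" for M M'
  proof -
    obtain b A b' A' where "M = affine_mat N b A" "affine_isometry b A"
      "M' = affine_mat N b' A'" "affine_isometry b' A'"
      using stabilizer_affine[OF N MM'(1)] stabilizer_affine[OF N MM'(2)] by metis
    then show ?thesis by (auto simp: affine_isometry_def affine_mat_mult mult_carrier_mat)
  qed
  moreover have "inj_on (linear_part N) stabilizer"
  proof (rule inj_onI)
    fix M M' assume MM': "M \<in> stabilizer" "M' \<in> stabilizer" "linear_part N M = linear_part N M'"
    obtain b A b' A' where "M = affine_mat N b A" "affine_isometry b A"
      "M' = affine_mat N b' A'" "affine_isometry b' A'"
      using stabilizer_affine[OF N MM'(1)] stabilizer_affine[OF N MM'(2)] by metis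
    then show "M = M'"
      using MM'(3) affine_isometry_unique by (auto simp: affine_isometry_def)
  qed
  moreover have "A \<in> linear_part N ` stabilizer" if A: "A \<in> ?Sp" for A
  proof -
    have A': "A \<in> carrier_mat N N" using A by (simp add: carrier_GL_iff)
    then obtain b where "affine_isometry b A"
      using affine_isometry_exists A by blast
    then have "affine_mat N b A \<in> stabilizer"
      using A' by (simp add: affine_mat_in_stabilizer_iff affine_isometry_def)
    then show ?thesis using A' by (metis image_eqI linear_part_affine_mat)
  qed
  ultimately show ?thesis
    using lin by (auto simp: iso_def hom_def bij_betw_def)
qed

end


section \<open>Sign cochains that are coboundaries\<close>

lemma carrier_field_units: "carrier (field_units :: 'k::field monoid) = {x. x \<noteq> 0}"
proof -
  have "\<exists>y. y * x = 1 \<and> x * y = 1" if "x \<noteq> 0" for x :: 'k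
    using that by (intro exI[of _ "inverse x"]) simp
  then show ?thesis by (auto simp: units_of_def Units_def class_ring_simps)
qed

lemma mult_field_units: "mult (field_units :: 'k::field monoid) = (*)"
  and one_field_units: "one (field_units :: 'k::field monoid) = 1"
  by (simp_all add: units_of_def class_ring_simps)

lemma inv_field_units:
  assumes "(x :: 'k::field) \<noteq> 0"
  shows "inv\<^bsub>field_units\<^esub> x = inverse x"
  unfolding m_inv_def
proof (rule the_equality)
  show "inverse x \<in> carrier field_units \<and> x \<otimes>\<^bsub>field_units\<^esub> inverse x = \<one>\<^bsub>field_units\<^esub> \<and>
      inverse x \<otimes>\<^bsub>field_units\<^esub> x = \<one>\<^bsub>field_units\<^esub>"
    using assms by (simp add: carrier_field_units mult_field_units one_field_units)
qed (use assms in \<open>auto simp: carrier_field_units mult_field_units one_field_units field_simps\<close>)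

abbreviation V3 :: "nat \<Rightarrow> (bit vec \<times> bit vec \<times> bit vec) set" where
  "V3 m \<equiv> carrier_vec m \<times> carrier_vec m \<times> carrier_vec m"

text \<open>Frees \<open>\<beta>\<close> from extensionality, so that plain formulas can serve as
  witnesses later.\<close>

lemma coboundaries3_iff:
  "\<omega> \<in> coboundaries3 (V2 m) (field_units :: 'k::field monoid) \<longleftrightarrow>
    (\<exists>\<beta>. (\<forall>u\<in>carrier_vec m. \<forall>v\<in>carrier_vec m. \<beta> (u, v) \<noteq> 0) \<and>
      \<omega> = (\<lambda>(u, v, w)\<in>V3 m. \<beta> (v, w) * \<beta> (u, v + w) / (\<beta> (u + v, w) * \<beta> (u, v))))"
  (is "?L \<longleftrightarrow> (\<exists>\<beta>. ?nz \<beta> \<and> \<omega> = ?d \<beta>)")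
proof -
  have d: "coboundary2 (V2 m) field_units \<beta> = ?d \<beta>" if "?nz \<beta>" for \<beta> :: "_ \<Rightarrow> 'k"
    using that unfolding coboundary2_def monoid_vec_simps mult_field_units
    by (intro restrict_ext) (auto simp: inv_field_units divide_inverse)
  have PiE: "(carrier_vec m \<times> carrier_vec m) \<rightarrow>\<^sub>E carrier (field_units :: 'k monoid) =
      {\<beta>. ?nz \<beta>} \<inter> extensional (carrier_vec m \<times> carrier_vec m)"
    by (auto simp: PiE_def Pi_def carrier_field_units)
  show ?thesis
  proof
    assume ?L
    then show "\<exists>\<beta>. ?nz \<beta> \<and> \<omega> = ?d \<beta>"
      using d by (auto simp: coboundaries3_def monoid_vec_simps PiE)
  next
    assume "\<exists>\<beta>. ?nz \<beta> \<and> \<omega> = ?d \<beta>"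
    then obtain \<beta> where \<beta>: "?nz \<beta>" "\<omega> = ?d \<beta>" by blast
    let ?\<beta> = "restrict \<beta> (carrier_vec m \<times> carrier_vec m)"
    have "\<omega> = ?d ?\<beta>"
      unfolding \<beta>(2) by (intro restrict_ext) auto
    then have "\<omega> = coboundary2 (V2 m) field_units ?\<beta>"
      using d[of ?\<beta>] \<beta>(1) by simp
    then show ?L
      using \<beta>(1) by (auto simp: coboundaries3_def monoid_vec_simps PiE)
  qed
qed

lemma coboundaries3_mult:
  fixes \<omega> \<psi> :: "bit vec \<times> bit vec \<times> bit vec \<Rightarrow> 'k::field"
  assumes "\<omega> \<in> coboundaries3 (V2 m) field_units" "\<psi> \<in> coboundaries3 (V2 m) field_units"
  shows "(\<lambda>x\<in>V3 m. \<omega> x * \<psi> x) \<in> coboundaries3 (V2 m) field_units"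
proof -
  obtain \<beta> where \<beta>: "\<forall>u\<in>carrier_vec m. \<forall>v\<in>carrier_vec m. \<beta> (u, v) \<noteq> 0"
    "\<omega> = (\<lambda>(u, v, w)\<in>V3 m. \<beta> (v, w) * \<beta> (u, v + w) / (\<beta> (u + v, w) * \<beta> (u, v)))"
    using assms(1) unfolding coboundaries3_iff by blast
  obtain \<gamma> where \<gamma>: "\<forall>u\<in>carrier_vec m. \<forall>v\<in>carrier_vec m. \<gamma> (u, v) \<noteq> 0"
    "\<psi> = (\<lambda>(u, v, w)\<in>V3 m. \<gamma> (v, w) * \<gamma> (u, v + w) / (\<gamma> (u + v, w) * \<gamma> (u, v)))"
    using assms(2) unfolding coboundaries3_iff by blast
  show ?thesis
    unfolding coboundaries3_iff
  proof (intro exI[of _ "\<lambda>x. \<beta> x * \<gamma> x"] conjI restrict_ext)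
    fix x :: "bit vec \<times> bit vec \<times> bit vec" assume "x \<in> V3 m"
    then show "\<omega> x * \<psi> x = (case x of (u, v, w) \<Rightarrow> (\<beta> (v, w) * \<gamma> (v, w)) *
        (\<beta> (u, v + w) * \<gamma> (u, v + w)) / (\<beta> (u + v, w) * \<gamma> (u + v, w) * (\<beta> (u, v) * \<gamma> (u, v))))"
      by (cases x) (simp add: \<beta>(2) \<gamma>(2) mult_ac)
  qed (use \<beta>(1) \<gamma>(1) in auto)
qed

lemma coboundaries3_pullback:
  fixes \<omega> :: "bit vec \<times> bit vec \<times> bit vec \<Rightarrow> 'k::field"
  assumes "\<omega> \<in> coboundaries3 (V2 m) field_units" and M: "M \<in> carrier_mat m m"
  shows "pullback3 (V2 m) (\<lambda>v. M *\<^sub>v v) \<omega> \<in> coboundaries3 (V2 m) field_units"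
proof -
  obtain \<beta> where \<beta>: "\<forall>u\<in>carrier_vec m. \<forall>v\<in>carrier_vec m. \<beta> (u, v) \<noteq> 0"
    "\<omega> = (\<lambda>(u, v, w)\<in>V3 m. \<beta> (v, w) * \<beta> (u, v + w) / (\<beta> (u + v, w) * \<beta> (u, v)))"
    using assms(1) unfolding coboundaries3_iff by blast
  show ?thesis
    unfolding coboundaries3_iff
  proof (intro exI[of _ "\<lambda>(u, v). \<beta> (M *\<^sub>v u, M *\<^sub>v v)"] conjI)
    show "pullback3 (V2 m) (\<lambda>v. M *\<^sub>v v) \<omega> = (\<lambda>(u, v, w)\<in>V3 m.
        (case (v, w) of (u, v) \<Rightarrow> \<beta> (M *\<^sub>v u, M *\<^sub>v v)) *
        (case (u, v + w) of (u, v) \<Rightarrow> \<beta> (M *\<^sub>v u, M *\<^sub>v v)) /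
        ((case (u + v, w) of (u, v) \<Rightarrow> \<beta> (M *\<^sub>v u, M *\<^sub>v v)) *
         (case (u, v) of (u, v) \<Rightarrow> \<beta> (M *\<^sub>v u, M *\<^sub>v v))))"
      unfolding pullback3_def monoid_vec_simps
    proof (rule restrict_ext)
      fix x :: "bit vec \<times> bit vec \<times> bit vec" assume "x \<in> V3 m"
      then show "(case x of (u, v, w) \<Rightarrow> \<omega> (M *\<^sub>v u, M *\<^sub>v v, M *\<^sub>v w)) = (case x of (u, v, w) \<Rightarrow>
          (case (v, w) of (u, v) \<Rightarrow> \<beta> (M *\<^sub>v u, M *\<^sub>v v)) *
          (case (u, v + w) of (u, v) \<Rightarrow> \<beta> (M *\<^sub>v u, M *\<^sub>v v)) /
          ((case (u + v, w) of (u, v) \<Rightarrow> \<beta> (M *\<^sub>v u, M *\<^sub>v v)) *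
           (case (u, v) of (u, v) \<Rightarrow> \<beta> (M *\<^sub>v u, M *\<^sub>v v))))"
        using M by (cases x) (simp add: \<beta>(2) mult_add_distrib_mat_vec[OF M])
    qed
  qed (use \<beta>(1) M in auto)
qed

text \<open>This is restriction to the subgroup {0, v}. Since v + v = 0, the first factor is
  \<open>\<beta>\<close> (v, 0) / \<open>\<beta>\<close> (0, v) and the second is its inverse; the
  second factor compensates for \<open>\<beta>\<close> not being normalized.\<close>

lemma coboundaries3_diagonal:
  fixes \<omega> :: "bit vec \<times> bit vec \<times> bit vec \<Rightarrow> 'k::field"
  assumes "\<omega> \<in> coboundaries3 (V2 m) field_units" and "v \<in> carrier_vec m"
  shows "\<omega> (v, v, v) * \<omega> (v, 0\<^sub>v m, v) = 1"
  using assms by (auto simp: coboundaries3_iff)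

text \<open>Cochains over F_2 whose class dies in the units of k. The field enters through a type
  argument, because it does not occur in the type of the cochains.\<close>

definition null_cochains :: "'k::field itself \<Rightarrow> nat \<Rightarrow> (bit vec \<times> bit vec \<times> bit vec \<Rightarrow> bit) set" where
  "null_cochains (_ :: 'k itself) m =
    {t. (\<lambda>x\<in>V3 m. sign_of_bit (t x) :: 'k) \<in> coboundaries3 (V2 m) field_units}"

lemma null_cochainsI:
  fixes \<beta> :: "bit vec \<times> bit vec \<Rightarrow> 'k::field"
  assumes nz: "\<And>u v. u \<in> carrier_vec m \<Longrightarrow> v \<in> carrier_vec m \<Longrightarrow> \<beta> (u, v) \<noteq> 0"
    and "\<And>u v w. u \<in> carrier_vec m \<Longrightarrow> v \<in> carrier_vec m \<Longrightarrow> w \<in> carrier_vec m \<Longrightarrow>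
      sign_of_bit (t (u, v, w)) * (\<beta> (u + v, w) * \<beta> (u, v)) = \<beta> (v, w) * \<beta> (u, v + w)"
  shows "t \<in> null_cochains TYPE('k) m"
  unfolding null_cochains_def coboundaries3_iff mem_Collect_eq
proof (intro exI[of _ \<beta>] conjI restrict_ext)
  fix x :: "bit vec \<times> bit vec \<times> bit vec" assume "x \<in> V3 m"
  then show "sign_of_bit (t x) =
      (case x of (u, v, w) \<Rightarrow> \<beta> (v, w) * \<beta> (u, v + w) / (\<beta> (u + v, w) * \<beta> (u, v)))"
    using assms by (cases x) (simp add: nonzero_eq_divide_eq)
qed (use nz in auto)

lemma null_cochains_coboundary:
  fixes \<gamma> :: "bit vec \<times> bit vec \<Rightarrow> bit"
  assumes "\<And>u v w. u \<in> carrier_vec m \<Longrightarrow> v \<in> carrier_vec m \<Longrightarrow> w \<in> carrier_vec m \<Longrightarrow>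
    t (u, v, w) = \<gamma> (v, w) + \<gamma> (u, v + w) + \<gamma> (u + v, w) + \<gamma> (u, v)"
  shows "t \<in> null_cochains TYPE('k::field) m"
proof (rule null_cochainsI[of _ "\<lambda>x. sign_of_bit (\<gamma> x)"])
  fix u v :: "bit vec"
  show "sign_of_bit (\<gamma> (u, v)) \<noteq> (0::'k)" by (simp add: sign_of_bit_def)
qed (auto simp: assms ac_simps simp flip: sign_of_bit_add)

lemma null_cochains_cong:
  assumes "t \<in> null_cochains TYPE('k::field) m" and "\<And>x. x \<in> V3 m \<Longrightarrow> t x = t' x"
  shows "t' \<in> null_cochains TYPE('k) m"
proof -
  have "(\<lambda>x\<in>V3 m. sign_of_bit (t x) :: 'k) = (\<lambda>x\<in>V3 m. sign_of_bit (t' x))"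
    using assms(2) by (intro restrict_ext) simp
  then show ?thesis using assms(1) by (simp add: null_cochains_def)
qed

lemma null_cochains_add:
  assumes "t \<in> null_cochains TYPE('k::field) m" "t' \<in> null_cochains TYPE('k) m"
  shows "(\<lambda>x. t x + t' x) \<in> null_cochains TYPE('k) m"
proof -
  have "(\<lambda>x\<in>V3 m. sign_of_bit (t x + t' x) :: 'k) = (\<lambda>x\<in>V3 m.
      (\<lambda>x\<in>V3 m. sign_of_bit (t x)) x * (\<lambda>x\<in>V3 m. sign_of_bit (t' x)) x)"
    by (intro restrict_ext) (simp add: sign_of_bit_add)
  then show ?thesis
    using coboundaries3_mult[OF assms[unfolded null_cochains_def mem_Collect_eq]]
    by (simp only: null_cochains_def mem_Collect_eq)
qed

lemma null_cochains_zero: "(\<lambda>x. 0) \<in> null_cochains TYPE('k::field) m"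
  by (rule null_cochains_coboundary[of _ _ "\<lambda>x. 0"]) simp

lemma null_cochains_sum:
  assumes "\<And>i. i \<in> I \<Longrightarrow> t i \<in> null_cochains TYPE('k::field) m"
  shows "(\<lambda>x. \<Sum>i\<in>I. c i * t i x) \<in> null_cochains TYPE('k) m"
  using assms
proof (induction I rule: infinite_finite_induct)
  case (insert i I)
  have "(\<lambda>x. c i * t i x) \<in> null_cochains TYPE('k) m"
    using insert.prems by (cases "c i") (auto intro: null_cochains_zero)
  then show ?case
    using insert null_cochains_add[of "\<lambda>x. c i * t i x" m "\<lambda>x. \<Sum>i\<in>I. c i * t i x"] by simp
qed (simp_all add: null_cochains_zero)

section \<open>Cup products of coordinate functions up to coboundaries\<close>

definition cup_monomial :: "nat \<times> nat \<times> nat \<Rightarrow> bit vec \<times> bit vec \<times> bit vec \<Rightarrow> bit" where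
  "cup_monomial = (\<lambda>(a, b, c) (u, v, w). u $ a * v $ b * w $ c)"

definition cohomologous_monomials ::
  "'k::field itself \<Rightarrow> nat \<Rightarrow> nat \<times> nat \<times> nat \<Rightarrow> nat \<times> nat \<times> nat \<Rightarrow> bool" where
  "cohomologous_monomials k m x y \<longleftrightarrow> (\<lambda>z. cup_monomial x z + cup_monomial y z) \<in> null_cochains k m"

lemma cohomologous_monomials_refl: "cohomologous_monomials TYPE('k::field) m x x"
  by (simp add: cohomologous_monomials_def null_cochains_zero)

lemma cohomologous_monomials_sym:
  "cohomologous_monomials TYPE('k::field) m x y \<Longrightarrow> cohomologous_monomials TYPE('k) m y x"
  by (simp add: cohomologous_monomials_def add.commute)

lemma cohomologous_monomials_trans:
  assumes "cohomologous_monomials TYPE('k::field) m x y" "cohomologous_monomials TYPE('k) m y z"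
  shows "cohomologous_monomials TYPE('k) m x z"
  using null_cochains_add[OF assms[unfolded cohomologous_monomials_def]]
  by (simp add: cohomologous_monomials_def add.assoc)

text \<open>The function u_a u_b fails to be additive by u_a v_b + u_b v_a, so the coboundary of u_a
  u_b v_c is the sum of the two monomials.\<close>

lemma cohomologous_monomials_swap_left:
  assumes "a < m" "b < m" "c < m"
  shows "cohomologous_monomials TYPE('k::field) m (a, b, c) (b, a, c)"
  unfolding cohomologous_monomials_def
  by (rule null_cochains_coboundary[of _ _ "\<lambda>(u, v). u $ a * u $ b * v $ c"])
    (use assms in \<open>auto simp: cup_monomial_def distrib_left distrib_right ac_simps\<close>)

lemma cohomologous_monomials_swap_right:
  assumes "a < m" "b < m" "c < m"
  shows "cohomologous_monomials TYPE('k::field) m (a, b, c) (a, c, b)"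
  unfolding cohomologous_monomials_def
  by (rule null_cochains_coboundary[of _ _ "\<lambda>(u, v). u $ a * v $ b * v $ c"])
    (use assms in \<open>auto simp: cup_monomial_def distrib_left distrib_right ac_simps\<close>)

text \<open>This is the only step that leaves \<open>\<F>\<^sub>2\<close>-coefficients: the cochain \<open>\<iota>\<^bsup>u\<^sub>a v\<^sub>b\<^esup>\<close> needs a
  square root of \<open>-1\<close>.\<close>

lemma cohomologous_monomials_collapse:
  assumes i: "\<iota> * \<iota> = (-1 :: 'k::field)" and "a < m" "b < m"
  shows "cohomologous_monomials TYPE('k) m (a, a, b) (a, b, b)"
  unfolding cohomologous_monomials_def
proof (rule null_cochainsI[of _ "\<lambda>(u, v). if u $ a * v $ b = 1 then \<iota> else 1"])
  fix u v w :: "bit vec"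
  show "(case (u, v) of (u, v) \<Rightarrow> if u $ a * v $ b = 1 then \<iota> else 1) \<noteq> 0"
    using i by auto
  assume "u \<in> carrier_vec m" "v \<in> carrier_vec m" "w \<in> carrier_vec m"
  then show "sign_of_bit (cup_monomial (a, a, b) (u, v, w) + cup_monomial (a, b, b) (u, v, w)) *
      ((case (u + v, w) of (u, v) \<Rightarrow> if u $ a * v $ b = 1 then \<iota> else 1) *
       (case (u, v) of (u, v) \<Rightarrow> if u $ a * v $ b = 1 then \<iota> else 1)) =
      (case (v, w) of (u, v) \<Rightarrow> if u $ a * v $ b = 1 then \<iota> else 1) *
      (case (u, v + w) of (u, v) \<Rightarrow> if u $ a * v $ b = 1 then \<iota> else 1)"
    using assms
    by (cases "u $ a"; cases "v $ a"; cases "v $ b"; cases "w $ b") (auto simp: cup_monomial_def)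
qed

lemma triple_of_pair:
  assumes "{p, q, r} = {x, y :: 'a}" and "x \<noteq> y"
  shows "(p, q, r) \<in> {(x, x, y), (x, y, x), (y, x, x)} \<or> (p, q, r) \<in> {(x, y, y), (y, x, y), (y, y, x)}"
proof -
  have "p = x \<or> p = y" "q = x \<or> q = y" "r = x \<or> r = y" "x = p \<or> x = q \<or> x = r" "y = p \<or> y = q \<or> y = r"
    using assms(1) by blast+
  then show ?thesis using assms(2) by auto
qed

lemma triple_permutation:
  assumes "a \<noteq> b" "b \<noteq> c" "a \<noteq> c" and "{a, b, c} = {a', b', c' :: 'a}"
  shows "(a', b', c') \<in> {(a, b, c), (a, c, b), (b, a, c), (b, c, a), (c, a, b), (c, b, a)}"
proof -
  have "a' = a \<or> a' = b \<or> a' = c" "b' = a \<or> b' = b \<or> b' = c" "c' = a \<or> c' = b \<or> c' = c"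
    "a = a' \<or> a = b' \<or> a = c'" "b = a' \<or> b = b' \<or> b = c'" "c = a' \<or> c = b' \<or> c = c'"
    using assms(4) by blast+
  then show ?thesis using assms(1-3) by auto
qed

text \<open>The two swaps generate all permutations. This suffices for one or three distinct
  indices; for two, the multiplicities may differ, and
  \<open>cohomologous_monomials_collapse\<close> links both triples to (x, x, y).\<close>

lemma cohomologous_monomials_same_indices:
  assumes i: "\<iota> * \<iota> = (-1 :: 'k::field)"
    and lt: "a < m" "b < m" "c < m" and eq: "{a, b, c} = {a', b', c'}"
  shows "cohomologous_monomials TYPE('k) m (a, b, c) (a', b', c')"
proof -
  let ?R = "cohomologous_monomials TYPE('k) m"
  note trans = cohomologous_monomials_trans[where 'k='k and m=m]
  have perm: "?R (p, q, r) (p, q, r)" "?R (p, q, r) (p, r, q)" "?R (p, q, r) (q, p, r)"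
    "?R (p, q, r) (q, r, p)" "?R (p, q, r) (r, p, q)" "?R (p, q, r) (r, q, p)"
    if "p < m" "q < m" "r < m" for p q r
  proof -
    note swap = cohomologous_monomials_swap_left[where 'k='k and m=m]
      cohomologous_monomials_swap_right[where 'k='k and m=m]
    show "?R (p, q, r) (p, q, r)" by (rule cohomologous_monomials_refl)
    show 1: "?R (p, q, r) (p, r, q)" and 2: "?R (p, q, r) (q, p, r)" using that by (auto intro: swap)
    show 3: "?R (p, q, r) (q, r, p)" by (rule trans[OF 2]) (use that in \<open>auto intro: swap\<close>)
    show "?R (p, q, r) (r, p, q)" by (rule trans[OF 1]) (use that in \<open>auto intro: swap\<close>)
    show "?R (p, q, r) (r, q, p)" by (rule trans[OF 3]) (use that in \<open>auto intro: swap\<close>)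
  qed
  have pair: "?R (x, x, y) (p, q, r)" if "x < m" "y < m" and "{p, q, r} = {x, y}" and "x \<noteq> y" for x y p q r
  proof -
    have xyy: "?R (x, x, y) (x, y, y)"
      by (rule cohomologous_monomials_collapse[OF i that(1,2)])
    have "(p, q, r) \<in> {(x, x, y), (x, y, x), (y, x, x)} \<or> (p, q, r) \<in> {(x, y, y), (y, x, y), (y, y, x)}"
      using that(3,4) by (rule triple_of_pair)
    then show ?thesis
    proof
      assume "(p, q, r) \<in> {(x, x, y), (x, y, x), (y, x, x)}"
      then show ?thesis using perm[of x x y] that(1,2) by auto
    next
      assume "(p, q, r) \<in> {(x, y, y), (y, x, y), (y, y, x)}"
      then have "?R (x, y, y) (p, q, r)" using perm[of x y y] that(1,2) by auto
      then show ?thesis by (rule trans[OF xyy])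
    qed
  qed
  show ?thesis
  proof (cases "\<exists>x y. x \<noteq> y \<and> {a, b, c} = {x, y}")
    case True
    then obtain x y where xy: "x \<noteq> y" "{a, b, c} = {x, y}" by blast
    then have "x < m" "y < m" using lt by auto
    then have "?R (x, x, y) (a, b, c)" "?R (x, x, y) (a', b', c')"
      using pair[of x y] xy eq by auto
    then show ?thesis using trans cohomologous_monomials_sym by blast
  next
    case False
    have "b = a \<Longrightarrow> c = a" "c = a \<Longrightarrow> b = a" "c = b \<Longrightarrow> b = a"
      using False by (force simp: insert_commute)+
    then consider "a = b" "b = c" | "a \<noteq> b" "b \<noteq> c" "a \<noteq> c" by blast
    then show ?thesis
    proof cases
      case 1
      then show ?thesis using eq by (auto intro: cohomologous_monomials_refl)
    next
      case 2
      then have "(a', b', c') \<in> {(a, b, c), (a, c, b), (b, a, c), (b, c, a), (c, a, b), (c, b, a)}"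
        using eq by (intro triple_permutation)
      then show ?thesis using perm[OF lt] by auto
    qed
  qed
qed

section \<open>Trilinear cochains vanishing on the diagonal\<close>

lemma trilinear_expansion:
  fixes t :: "bit vec \<times> bit vec \<times> bit vec \<Rightarrow> bit"
  assumes add1: "\<And>u u' v w. \<lbrakk>u \<in> carrier_vec m; u' \<in> carrier_vec m; v \<in> carrier_vec m; w \<in> carrier_vec m\<rbrakk>
      \<Longrightarrow> t (u + u', v, w) = t (u, v, w) + t (u', v, w)"
    and add2: "\<And>u v v' w. \<lbrakk>u \<in> carrier_vec m; v \<in> carrier_vec m; v' \<in> carrier_vec m; w \<in> carrier_vec m\<rbrakk>
      \<Longrightarrow> t (u, v + v', w) = t (u, v, w) + t (u, v', w)"
    and add3: "\<And>u v w w'. \<lbrakk>u \<in> carrier_vec m; v \<in> carrier_vec m; w \<in> carrier_vec m; w' \<in> carrier_vec m\<rbrakk>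
      \<Longrightarrow> t (u, v, w + w') = t (u, v, w) + t (u, v, w')"
    and x: "x \<in> V3 m"
  shows "t x = (\<Sum>(a, b, c)\<in>{..<m} \<times> {..<m} \<times> {..<m}.
    t (unit_vec m a, unit_vec m b, unit_vec m c) * cup_monomial (a, b, c) x)"
proof -
  obtain u v w where x': "x = (u, v, w)" "u \<in> carrier_vec m" "v \<in> carrier_vec m" "w \<in> carrier_vec m"
    using x by auto
  have "t (u, v, w) = (\<Sum>a<m. u $ a * t (unit_vec m a, v, w))"
    by (rule bit_additive_expansion[of m "\<lambda>u. t (u, v, w)"]) (use x' add1 in auto)
  also have "\<dots> = (\<Sum>a<m. u $ a * (\<Sum>b<m. v $ b * t (unit_vec m a, unit_vec m b, w)))"
    by (intro sum.cong refl arg_cong2[of _ _ _ _ "(*)"]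
        bit_additive_expansion[of m "\<lambda>v. t (unit_vec m _, v, w)"]) (use x' add2 in auto)
  also have "\<dots> = (\<Sum>a<m. u $ a * (\<Sum>b<m. v $ b *
      (\<Sum>c<m. w $ c * t (unit_vec m a, unit_vec m b, unit_vec m c))))"
    by (intro sum.cong refl arg_cong2[of _ _ _ _ "(*)"]
        bit_additive_expansion[of m "\<lambda>w. t (unit_vec m _, unit_vec m _, w)"]) (use x' add3 in auto)
  finally show ?thesis
    by (simp add: x' cup_monomial_def sum_distrib_left ac_simps flip: sum.cartesian_product)
qed

text \<open>Moebius inversion over subsets, in the case of zero sums: by induction all proper
  subsets contribute 0, so the sum over the power set reduces to \<open>F T\<close>.\<close>

lemma sum_fibers_vanish:
  fixes F :: "nat set \<Rightarrow> bit"
  assumes "\<And>T. T \<subseteq> {..<m} \<Longrightarrow> (\<Sum>T'\<in>Pow T. F T') = 0" and "T \<subseteq> {..<m}"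
  shows "F T = 0"
proof -
  have "finite T" using assms(2) finite_subset by blast
  then show ?thesis
    using assms(2)
  proof (induction T rule: finite_psubset_induct)
    case (psubset T)
    have "Pow T = insert T (Pow T - {T})" by auto
    then have "(\<Sum>T'\<in>Pow T. F T') = F T + (\<Sum>T'\<in>Pow T - {T}. F T')"
      using psubset.hyps by (metis finite_Diff finite_Pow_iff sum.insert_remove insert_Diff_single Pow_top sum.remove)
    also have "(\<Sum>T'\<in>Pow T - {T}. F T') = 0"
      using psubset by (intro sum.neutral) auto
    finally show ?case using assms(1) psubset.prems by simp
  qed
qed

text \<open>A monomial depends, up to coboundaries, only on the set of its indices, and the sum of the
  coefficients belonging to a set is obtained by Moebius inversion from the values of \<open>t\<close> on the
  diagonal, at indicator vectors.\<close>

lemma trilinear_null_cochain: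
  fixes t :: "bit vec \<times> bit vec \<times> bit vec \<Rightarrow> bit"
  assumes i: "\<iota> * \<iota> = (-1 :: 'k::field)"
    and add1: "\<And>u u' v w. \<lbrakk>u \<in> carrier_vec m; u' \<in> carrier_vec m; v \<in> carrier_vec m; w \<in> carrier_vec m\<rbrakk>
      \<Longrightarrow> t (u + u', v, w) = t (u, v, w) + t (u', v, w)"
    and add2: "\<And>u v v' w. \<lbrakk>u \<in> carrier_vec m; v \<in> carrier_vec m; v' \<in> carrier_vec m; w \<in> carrier_vec m\<rbrakk>
      \<Longrightarrow> t (u, v + v', w) = t (u, v, w) + t (u, v', w)"
    and add3: "\<And>u v w w'. \<lbrakk>u \<in> carrier_vec m; v \<in> carrier_vec m; w \<in> carrier_vec m; w' \<in> carrier_vec m\<rbrakk>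
      \<Longrightarrow> t (u, v, w + w') = t (u, v, w) + t (u, v, w')"
    and diag: "\<And>v. v \<in> carrier_vec m \<Longrightarrow> t (v, v, v) = 0"
  shows "t \<in> null_cochains TYPE('k) m"
proof -
  define I where "I = {..<m} \<times> {..<m} \<times> {..<m}"
  define \<tau> where "\<tau> = (\<lambda>(a, b, c). t (unit_vec m a, unit_vec m b, unit_vec m c))"
  define S where "S = (\<lambda>(a, b, c). {a, b, c :: nat})"
  \<comment> \<open>One chosen monomial for each index set that occurs; for other sets the value is
    arbitrary, but there \<open>F T\<close> is an empty sum.\<close>
  define rep where "rep T = (SOME x. x \<in> I \<and> S x = T)" for T
  have fin: "finite I" by (simp add: I_def)
  have expansion: "t x = (\<Sum>y\<in>I. \<tau> y * cup_monomial y x)" if "x \<in> V3 m" for x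
    using trilinear_expansion[of m t x, OF add1 add2 add3 that]
    by (simp add: I_def \<tau>_def case_prod_unfold)
  have S_image: "S ` I \<subseteq> Pow {..<m}"
    by (auto simp: I_def S_def)
  define F where "F T = (\<Sum>y\<in>{y\<in>I. S y = T}. \<tau> y)" for T
  have "(\<Sum>T'\<in>Pow T. F T') = 0" if T: "T \<subseteq> {..<m}" for T
  proof -
    let ?v = "vec m (\<lambda>i. if i \<in> T then 1 else 0 :: bit)"
    have "finite (Pow T)" using T finite_subset by auto
    have "0 = (\<Sum>y\<in>I. \<tau> y * cup_monomial y (?v, ?v, ?v))"
      using diag[of ?v] expansion[of "(?v, ?v, ?v)"] by simp
    \<comment> \<open>At the indicator vector of \<open>T\<close> a monomial is 1 exactly when all
      its indices lie in \<open>T\<close>.\<close>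
    also have "\<dots> = (\<Sum>y\<in>I. if S y \<in> Pow T then \<tau> y else 0)"
      by (intro sum.cong refl) (auto simp: I_def S_def cup_monomial_def)
    also have "\<dots> = (\<Sum>y\<in>{y\<in>I. S y \<in> Pow T}. \<tau> y)"
      using fin by (simp add: sum.inter_filter)
    also have "\<dots> = (\<Sum>T'\<in>Pow T. \<Sum>y\<in>{y\<in>{y\<in>I. S y \<in> Pow T}. S y = T'}. \<tau> y)"
      using fin \<open>finite (Pow T)\<close> by (intro sum.group[symmetric]) auto
    also have "\<dots> = (\<Sum>T'\<in>Pow T. F T')"
      unfolding F_def by (intro sum.cong refl) auto
    finally show ?thesis by simp
  qed
  then have F_0: "F T = 0" if "T \<subseteq> {..<m}" for T
    using sum_fibers_vanish[of m F T] that by blast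
  have rep: "(\<lambda>x. cup_monomial y x + cup_monomial (rep (S y)) x) \<in> null_cochains TYPE('k) m"
    if y: "y \<in> I" for y
  proof -
    have "rep (S y) \<in> I \<and> S (rep (S y)) = S y"
      unfolding rep_def by (rule someI[of _ y]) (use y in simp)
    then have "cohomologous_monomials TYPE('k) m y (rep (S y))"
      using y cohomologous_monomials_same_indices[OF i]
      by (cases y; cases "rep (S y)") (auto simp: I_def S_def)
    then show ?thesis by (simp add: cohomologous_monomials_def)
  qed
  have "(\<lambda>x. \<Sum>y\<in>I. \<tau> y * (cup_monomial y x + cup_monomial (rep (S y)) x)) \<in> null_cochains TYPE('k) m"
    by (rule null_cochains_sum) (rule rep)
  then show ?thesis
  proof (rule null_cochains_cong)
    fix x assume x: "x \<in> V3 m"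
    \<comment> \<open>Once every monomial is replaced by its representative, the coefficients
      collect to the vanishing sums \<open>F T\<close>.\<close>
    have "(\<Sum>y\<in>I. \<tau> y * cup_monomial (rep (S y)) x) =
        (\<Sum>T\<in>Pow {..<m}. \<Sum>y\<in>{y\<in>I. S y = T}. \<tau> y * cup_monomial (rep (S y)) x)"
      using fin S_image by (intro sum.group[symmetric]) auto
    also have "\<dots> = (\<Sum>T\<in>Pow {..<m}. F T * cup_monomial (rep T) x)"
      unfolding F_def sum_distrib_right by (intro sum.cong refl) auto
    also have "\<dots> = 0"
      using F_0 by (intro sum.neutral) auto
    finally show "(\<Sum>y\<in>I. \<tau> y * (cup_monomial y x + cup_monomial (rep (S y)) x)) = t x"
      by (simp add: distrib_left sum.distrib expansion[OF x])
  qed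
qed

section \<open>Classes of cubic polynomials and their stabilizers\<close>

lemma cubic_cochain_add_1:
  assumes "u \<in> carrier_vec m" "u' \<in> carrier_vec m" "v \<in> carrier_vec m" "w \<in> carrier_vec m"
  shows "cubic_cochain m p (u + u', v, w) = cubic_cochain m p (u, v, w) + cubic_cochain m p (u', v, w)"
  unfolding cubic_cochain_def prod.case sum.distrib[symmetric]
  by (intro sum.cong refl) (use assms in \<open>auto simp: distrib_left distrib_right\<close>)

lemma cubic_cochain_add_2:
  assumes "u \<in> carrier_vec m" "v \<in> carrier_vec m" "v' \<in> carrier_vec m" "w \<in> carrier_vec m"
  shows "cubic_cochain m p (u, v + v', w) = cubic_cochain m p (u, v, w) + cubic_cochain m p (u, v', w)"
  unfolding cubic_cochain_def prod.case sum.distrib[symmetric]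
  by (intro sum.cong refl) (use assms in \<open>auto simp: distrib_left distrib_right\<close>)

lemma cubic_cochain_add_3:
  assumes "u \<in> carrier_vec m" "v \<in> carrier_vec m" "w \<in> carrier_vec m" "w' \<in> carrier_vec m"
  shows "cubic_cochain m p (u, v, w + w') = cubic_cochain m p (u, v, w) + cubic_cochain m p (u, v, w')"
  unfolding cubic_cochain_def prod.case sum.distrib[symmetric]
  by (intro sum.cong refl) (use assms in \<open>auto simp: distrib_left distrib_right\<close>)

lemmas cubic_cochain_add = cubic_cochain_add_1 cubic_cochain_add_2 cubic_cochain_add_3

lemma cubic_cochain_zero_middle:
  assumes "u \<in> carrier_vec m" "w \<in> carrier_vec m"
  shows "cubic_cochain m p (u, 0\<^sub>v m, w) = 0"
  using cubic_cochain_add_2[of u m "0\<^sub>v m" "0\<^sub>v m" w p] assms by simp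

lemma mem_cubic_class_iff:
  "\<omega> \<in> (cubic_class m p :: (_ \<Rightarrow> 'k::field) set) \<longleftrightarrow>
    (\<exists>\<psi>\<in>coboundaries3 (V2 m) field_units. \<omega> = (\<lambda>x\<in>V3 m. \<psi> x * cubic_cocycle m p x))"
  by (auto simp: cubic_class_def cohomology_class_def r_coset_def cochains3_def monoid_vec_simps
      mult_field_units)

lemma sign_cochain_in_cubic_class:
  assumes "(\<lambda>x. t x + cubic_cochain m p x) \<in> null_cochains TYPE('k::field) m"
  shows "(\<lambda>x\<in>V3 m. sign_of_bit (t x) :: 'k) \<in> cubic_class m p"
proof -
  have "(\<lambda>x\<in>V3 m. sign_of_bit (t x) :: 'k) = (\<lambda>x\<in>V3 m.
      (\<lambda>x\<in>V3 m. sign_of_bit (t x + cubic_cochain m p x)) x * cubic_cocycle m p x)"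
    by (intro restrict_ext)
      (simp add: cubic_cocycle_def monoid_vec_simps add.assoc flip: sign_of_bit_add)
  then show ?thesis
    using assms unfolding mem_cubic_class_iff null_cochains_def by blast
qed

text \<open>The left side ignores coboundaries, and a trilinear cochain vanishes at (v, 0, v), so
  every representative of the class records the value of the polynomial at \<open>v\<close>.\<close>

lemma cubic_class_diagonal:
  fixes \<omega> :: "_ \<Rightarrow> 'k::field"
  assumes "\<omega> \<in> cubic_class m p" and v: "v \<in> carrier_vec m"
  shows "\<omega> (v, v, v) * \<omega> (v, 0\<^sub>v m, v) = sign_of_bit (cubic_cochain m p (v, v, v))"
proof -
  obtain \<psi> where \<psi>: "\<psi> \<in> coboundaries3 (V2 m) (field_units :: 'k monoid)"
    "\<omega> = (\<lambda>x\<in>V3 m. \<psi> x * cubic_cocycle m p x)"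
    using assms(1) unfolding mem_cubic_class_iff by blast
  have "\<omega> (v, v, v) * \<omega> (v, 0\<^sub>v m, v) = (\<psi> (v, v, v) * \<psi> (v, 0\<^sub>v m, v)) *
      (cubic_cocycle m p (v, v, v) * cubic_cocycle m p (v, 0\<^sub>v m, v))"
    using v by (simp add: \<psi>(2) mult_ac)
  also have "\<psi> (v, v, v) * \<psi> (v, 0\<^sub>v m, v) = 1"
    by (rule coboundaries3_diagonal[OF \<psi>(1) v])
  finally show ?thesis
    using v by (simp add: cubic_cocycle_def monoid_vec_simps cubic_cochain_zero_middle)
qed

lemma pullback_cubic_cocycle:
  assumes M: "M \<in> carrier_mat m m"
  shows "pullback3 (V2 m) (\<lambda>v. M *\<^sub>v v) (cubic_cocycle m p :: _ \<Rightarrow> 'k::field) =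
    (\<lambda>x\<in>V3 m. sign_of_bit (case x of (u, v, w) \<Rightarrow> cubic_cochain m p (M *\<^sub>v u, M *\<^sub>v v, M *\<^sub>v w)))"
  unfolding pullback3_def monoid_vec_simps
  by (rule restrict_ext) (use M in \<open>auto simp: cubic_cocycle_def monoid_vec_simps\<close>)

text \<open>Reduces the quantifier over all representatives in \<open>Stab\<close> to the single
  representative \<open>cubic_cocycle m p\<close>.\<close>

lemma pullback_mem_cubic_class:
  assumes M: "M \<in> carrier_mat m m"
    and base: "pullback3 (V2 m) (\<lambda>v. M *\<^sub>v v) (cubic_cocycle m p) \<in> (cubic_class m p :: (_ \<Rightarrow> 'k::field) set)"
    and \<omega>: "\<omega> \<in> (cubic_class m p :: (_ \<Rightarrow> 'k) set)"
  shows "pullback3 (V2 m) (\<lambda>v. M *\<^sub>v v) \<omega> \<in> cubic_class m p"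
proof -
  let ?P = "pullback3 (V2 m) (\<lambda>v. M *\<^sub>v v) :: _ \<Rightarrow> _ \<Rightarrow> 'k"
  obtain \<psi> where \<psi>: "\<psi> \<in> coboundaries3 (V2 m) (field_units :: 'k monoid)"
    "\<omega> = (\<lambda>x\<in>V3 m. \<psi> x * cubic_cocycle m p x)"
    using \<omega> unfolding mem_cubic_class_iff by blast
  obtain \<psi>' where \<psi>': "\<psi>' \<in> coboundaries3 (V2 m) (field_units :: 'k monoid)"
    "?P (cubic_cocycle m p) = (\<lambda>x\<in>V3 m. \<psi>' x * cubic_cocycle m p x)"
    using base unfolding mem_cubic_class_iff by blast
  have "?P \<omega> = (\<lambda>x\<in>V3 m. (\<lambda>x\<in>V3 m. ?P \<psi> x * \<psi>' x) x * cubic_cocycle m p x)"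
  proof
    fix x
    show "?P \<omega> x = (\<lambda>x\<in>V3 m. (\<lambda>x\<in>V3 m. ?P \<psi> x * \<psi>' x) x * cubic_cocycle m p x) x"
    proof (cases "x \<in> V3 m")
      case True
      then obtain u v w where x: "x = (u, v, w)" "u \<in> carrier_vec m" "v \<in> carrier_vec m" "w \<in> carrier_vec m"
        by auto
      have "?P \<omega> x = ?P \<psi> x * ?P (cubic_cocycle m p) x"
        using x M by (simp add: pullback3_def monoid_vec_simps \<psi>(2))
      also have "\<dots> = ?P \<psi> x * (\<psi>' x * cubic_cocycle m p x)"
        using True by (simp add: \<psi>'(2))
      finally show ?thesis using True by (simp add: mult.assoc)
    next
      case False
      then show ?thesis by (simp add: pullback3_def monoid_vec_simps)
    qed
  qed
  then show ?thesis
    using coboundaries3_mult[OF coboundaries3_pullback[OF \<psi>(1) M] \<psi>'(1)]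
    unfolding mem_cubic_class_iff by blast
qed

lemma cubic_cocycle_mem_cubic_class: "cubic_cocycle m p \<in> (cubic_class m p :: (_ \<Rightarrow> 'k::field) set)"
  using sign_cochain_in_cubic_class[of "cubic_cochain m p" m p, where 'k='k]
  by (simp add: null_cochains_zero cubic_cocycle_def monoid_vec_simps)

text \<open>Diagonal values are invariants of the class, which gives one inclusion. For the other,
  the pulled back cochain plus the original one is trilinear and zero on the diagonal, so
  \<open>trilinear_null_cochain\<close> applies.\<close>

lemma Stab_cubic_class:
  fixes p :: bit_mpoly
  assumes i: "\<iota> * \<iota> = (-1 :: 'k::field_char_0)"
  shows "Stab m (cubic_class m p :: (_ \<Rightarrow> 'k) set) = (GL m)\<lparr>carrier := {M \<in> carrier (GL m).
    \<forall>v\<in>carrier_vec m. cubic_cochain m p (M *\<^sub>v v, M *\<^sub>v v, M *\<^sub>v v) = cubic_cochain m p (v, v, v)}\<rparr>"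
proof -
  have "(\<forall>\<omega>\<in>(cubic_class m p :: (_ \<Rightarrow> 'k) set). pullback3 (V2 m) (\<lambda>v. M *\<^sub>v v) \<omega> \<in> cubic_class m p) \<longleftrightarrow>
      (\<forall>v\<in>carrier_vec m. cubic_cochain m p (M *\<^sub>v v, M *\<^sub>v v, M *\<^sub>v v) = cubic_cochain m p (v, v, v))"
    (is "?L \<longleftrightarrow> ?R")
    if "M \<in> carrier (GL m)" for M
  proof -
    have M: "M \<in> carrier_mat m m"
      using that by (simp add: GL_def units_of_def Units_def ring_mat_simps)
    let ?t = "\<lambda>(u, v, w). cubic_cochain m p (M *\<^sub>v u, M *\<^sub>v v, M *\<^sub>v w)"
    let ?P = "pullback3 (V2 m) (\<lambda>v. M *\<^sub>v v) (cubic_cocycle m p) :: _ \<Rightarrow> 'k"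
    show ?thesis
    proof
      assume ?L
      then have mem: "?P \<in> cubic_class m p"
        using cubic_cocycle_mem_cubic_class by blast
      show ?R
      proof
        fix v :: "bit vec" assume v: "v \<in> carrier_vec m"
        have Mv: "M *\<^sub>v v \<in> carrier_vec m" "M *\<^sub>v 0\<^sub>v m = 0\<^sub>v m" using M v by auto
        have "sign_of_bit (cubic_cochain m p (M *\<^sub>v v, M *\<^sub>v v, M *\<^sub>v v)) =
            (sign_of_bit (cubic_cochain m p (v, v, v)) :: 'k)"
          using cubic_class_diagonal[OF mem v] v Mv
          by (simp add: pullback_cubic_cocycle[OF M] cubic_cochain_zero_middle)
        \<comment> \<open>In characteristic 0 the signs 1 and -1 differ, so a sign determines its
          bit.\<close>
        then show "cubic_cochain m p (M *\<^sub>v v, M *\<^sub>v v, M *\<^sub>v v) = cubic_cochain m p (v, v, v)"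
          by (simp add: sign_of_bit_def split: if_splits)
      qed
    next
      assume R: ?R
      have "(\<lambda>x. ?t x + cubic_cochain m p x) \<in> null_cochains TYPE('k) m"
        by (rule trilinear_null_cochain[OF i])
          (use M R in \<open>simp_all add: mult_add_distrib_mat_vec[OF M] cubic_cochain_add ac_simps\<close>)
      then have "?P \<in> cubic_class m p"
        using sign_cochain_in_cubic_class[of ?t m p, where 'k='k]
        by (simp add: pullback_cubic_cocycle[OF M])
      then show ?L
        using pullback_mem_cubic_class[OF M] by blast
    qed
  qed
  then show ?thesis
    unfolding Stab_def by (intro arg_cong[where f = "\<lambda>c. (GL m)\<lparr>carrier := c\<rparr>"] Collect_cong) blast
qed


section \<open>The two cubic classes\<close>

text \<open>Over F_2 the entries -1 and 1 agree, so the Gram matrix just swaps the two coordinates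
  of each hyperbolic pair.\<close>

lemma symplectic_gram_mult_vec:
  assumes y: "y \<in> carrier_vec (2 * n)" and i: "i < 2 * n"
  shows "((symplectic_gram n :: bit mat) *\<^sub>v y) $ i = y $ (if even i then i + 1 else i - 1)"
proof -
  let ?s = "if even i then i + 1 else i - 1"
  have s: "?s < 2 * n" using i by (auto elim: evenE)
  have "((symplectic_gram n :: bit mat) *\<^sub>v y) $ i = (\<Sum>j<2 * n. symplectic_gram n $$ (i, j) * y $ j)"
    using i y by (simp add: symplectic_gram_def scalar_prod_def lessThan_atLeast0)
  also have "\<dots> = (\<Sum>j<2 * n. if j = ?s then y $ j else 0)"
    using i by (intro sum.cong refl) (auto simp: symplectic_gram_def)
  also have "\<dots> = y $ ?s" using s by simp
  finally show ?thesis .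
qed

lemma symplectic_gram_carrier [simp]: "symplectic_gram n \<in> carrier_mat (2 * n) (2 * n)"
  by (simp add: symplectic_gram_def)

lemma symplectic_gram_square:
  "(symplectic_gram n :: bit mat) * symplectic_gram n = 1\<^sub>m (2 * n)"
proof (rule mat_eq_if_mult_vec_eq[of _ "2 * n" "2 * n"])
  fix v :: "bit vec" assume v: "v \<in> carrier_vec (2 * n)"
  let ?J = "symplectic_gram n :: bit mat"
  have Jv: "?J *\<^sub>v v \<in> carrier_vec (2 * n)"
    using v by (intro mult_mat_vec_carrier) auto
  have "?J *\<^sub>v (?J *\<^sub>v v) = v"
  proof (rule eq_vecI)
    fix i assume "i < dim_vec v"
    then have i: "i < 2 * n" using v by simp
    then have "(if even i then i + 1 else i - 1) < 2 * n" by (auto elim: evenE)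
    then show "(?J *\<^sub>v (?J *\<^sub>v v)) $ i = v $ i"
      using i by (simp only: symplectic_gram_mult_vec[OF Jv] symplectic_gram_mult_vec[OF v])
        (auto elim: oddE)
  qed (use v in \<open>simp add: symplectic_gram_def\<close>)
  then show "?J * ?J *\<^sub>v v = 1\<^sub>m (2 * n) *\<^sub>v v"
    using v by (simp add: assoc_mult_mat_vec[of _ "2 * n" "2 * n" _ "2 * n"])
qed (simp_all add: mult_carrier_mat[of _ "2 * n" "2 * n" _ "2 * n"])

lemma sum_pairs: "(\<Sum>i<2 * n. f i) = (\<Sum>i<n. f (2 * i) + f (2 * i + 1 :: nat))"
  for f :: "nat \<Rightarrow> 'a::comm_monoid_add"
  by (induction n) (simp_all add: add.assoc)

definition hyperbolic_form :: "nat \<Rightarrow> bit vec \<Rightarrow> bit" where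
  "hyperbolic_form n x = (\<Sum>i<n. x $ (2 * i) * x $ (2 * i + 1))"

lemma bit_quadratic_form_hyperbolic:
  "bit_quadratic_form (2 * n) (symplectic_gram n) (hyperbolic_form n)"
proof
  fix x y :: "bit vec" assume xy: "x \<in> carrier_vec (2 * n)" "y \<in> carrier_vec (2 * n)"
  have "x \<bullet> (symplectic_gram n *\<^sub>v y) =
      (\<Sum>i<2 * n. x $ i * y $ (if even i then i + 1 else i - 1))"
    unfolding scalar_prod_def
    by (intro sum.cong) (auto simp: symplectic_gram_mult_vec[OF xy(2)] carrier_matD[OF symplectic_gram_carrier]
        simp del: index_mult_mat_vec)
  also have "\<dots> = (\<Sum>i<n. x $ (2 * i) * y $ (2 * i + 1) + x $ (2 * i + 1) * y $ (2 * i))"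
    by (simp add: sum_pairs)
  finally have B: "x \<bullet> (symplectic_gram n *\<^sub>v y) = \<dots>" .
  show "hyperbolic_form n (x + y) = hyperbolic_form n x + hyperbolic_form n y +
      x \<bullet> (symplectic_gram n *\<^sub>v y)"
    unfolding B hyperbolic_form_def sum.distrib[symmetric]
    by (intro sum.cong refl) (use xy in \<open>simp add: distrib_left distrib_right add_ac\<close>)
qed (simp_all add: symplectic_gram_square)

text \<open>Additive functions have zero polarization. This leads from the form of
  \<open>omega_D\<close> to that of \<open>omega_Q\<close>, since squares of coordinates are
  additive over F_2.\<close>

lemma bit_quadratic_form_add_linear:
  assumes "bit_quadratic_form N J q"
    and "\<And>x y. x \<in> carrier_vec N \<Longrightarrow> y \<in> carrier_vec N \<Longrightarrow> l (x + y) = l x + l y"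
  shows "bit_quadratic_form N J (\<lambda>x. q x + l x)"
  using assms by (auto simp: bit_quadratic_form_def ac_simps)

section \<open>Evaluation of the two explicit cubics\<close>

lemma sorted_exponents_inject:
  fixes a b c i j k :: nat
  assumes "a \<le> b" "b \<le> c" "i \<le> j" "j \<le> k"
    and eq: "Poly_Mapping.single a 1 + Poly_Mapping.single b 1 + Poly_Mapping.single c (1::nat) =
      Poly_Mapping.single i 1 + Poly_Mapping.single j 1 + Poly_Mapping.single k 1"
  shows "a = i \<and> b = j \<and> c = k"
proof -
  \<comment> \<open>An exponent vector is the multiplicity function of a multiset, and a sorted
    triple is the sorted list of its multiset.\<close>
  have count: "count {#a, b, c#} x = Poly_Mapping.lookup
      (Poly_Mapping.single a 1 + Poly_Mapping.single b 1 + Poly_Mapping.single c 1) x" for a b c x :: nat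
    by (auto simp: lookup_add lookup_single when_def)
  have "count {#a, b, c#} x = count {#i, j, k#} x" for x
    unfolding count eq ..
  then have "sorted_list_of_multiset {#a, b, c#} = sorted_list_of_multiset {#i, j, k#}"
    by (metis multiset_eq_iff)
  moreover have "sorted_list_of_multiset {#a, b, c#} = [a, b, c]"
    "sorted_list_of_multiset {#i, j, k#} = [i, j, k]"
    using assms(1-4) by auto
  ultimately show ?thesis by simp
qed

lemma cubic_cochain_monomial:
  assumes "i \<le> j" "j \<le> k" "k < m"
  shows "cubic_cochain m (X i * X j * X k) (u, v, w) = u $ i * v $ j * w $ k"
proof -
  let ?T = "{(a, b, c). a \<le> b \<and> b \<le> c \<and> c < m}"
  have "finite ?T"
    by (rule finite_subset[of _ "{..<m} \<times> {..<m} \<times> {..<m}"]) auto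
  have "cubic_cochain m (X i * X j * X k) (u, v, w) =
      (\<Sum>x\<in>?T. if x = (i, j, k) then u $ i * v $ j * w $ k else 0)"
    unfolding cubic_cochain_def prod.case
  proof (intro sum.cong refl)
    fix x assume "x \<in> ?T"
    then obtain a b c where x: "x = (a, b, c)" "a \<le> b" "b \<le> c" by auto
    have "Poly_Mapping.lookup (X i * X j * X k) (Poly_Mapping.single a 1 + Poly_Mapping.single b 1 +
        Poly_Mapping.single c 1) = (if (a, b, c) = (i, j, k) then 1 else 0)"
    proof (cases "(a, b, c) = (i, j, k)")
      case True
      then show ?thesis by (simp add: X_def mult_single)
    next
      case False
      then have "Poly_Mapping.single i 1 + Poly_Mapping.single j 1 + Poly_Mapping.single k (1::nat) \<noteq>
          Poly_Mapping.single a 1 + Poly_Mapping.single b 1 + Poly_Mapping.single c 1"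
        using sorted_exponents_inject[OF assms(1,2) x(2,3)] by blast
      then show ?thesis using False by (simp only: X_def mult_single lookup_single when_def if_False)
    qed
    then show "(case x of (a, b, c) \<Rightarrow> Poly_Mapping.lookup (X i * X j * X k)
          (Poly_Mapping.single a 1 + Poly_Mapping.single b 1 + Poly_Mapping.single c 1) *
        (u $ a * v $ b * w $ c)) = (if x = (i, j, k) then u $ i * v $ j * w $ k else 0)"
      by (simp only: x prod.case) simp
  qed
  also have "\<dots> = u $ i * v $ j * w $ k"
    using \<open>finite ?T\<close> assms by simp
  finally show ?thesis .
qed

lemma cubic_cochain_poly_add: "cubic_cochain m (p + q) x = cubic_cochain m p x + cubic_cochain m q x"
  by (cases x) (simp add: cubic_cochain_def lookup_add distrib_right case_prod_unfold sum.distrib)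

lemma cubic_cochain_poly_sum: "cubic_cochain m (\<Sum>i\<in>I. p i) x = (\<Sum>i\<in>I. cubic_cochain m (p i) x)"
proof (induction I rule: infinite_finite_induct)
  case (insert i I)
  then show ?case by (simp add: cubic_cochain_poly_add)
qed (cases x; simp add: cubic_cochain_def)+

lemma cubic_cochain_hyperbolic:
  assumes "v \<in> carrier_vec (Suc (2 * n))"
  shows "cubic_cochain (Suc (2 * n)) (\<Sum>i=1..n. X 0 * X (2 * i - 1) * X (2 * i)) (v, v, v) =
    homogenize (2 * n) (hyperbolic_form n) v"
proof -
  have "cubic_cochain (Suc (2 * n)) (\<Sum>i=1..n. X 0 * X (2 * i - 1) * X (2 * i)) (v, v, v) =
      (\<Sum>i=1..n. v $ 0 * v $ (2 * i - 1) * v $ (2 * i))"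
    unfolding cubic_cochain_poly_sum by (intro sum.cong refl cubic_cochain_monomial) auto
  \<comment> \<open>The index now starts at 0; removing coordinate 0 of \<open>v\<close> then moves
    the pair to positions 2i and 2i + 1, as in \<open>hyperbolic_form\<close>.\<close>
  also have "\<dots> = (\<Sum>i<n. v $ 0 * v $ Suc (2 * i) * v $ Suc (Suc (2 * i)))"
    by (simp add: sum.atLeast1_atMost_eq)
  finally show ?thesis
    by (simp add: homogenize_def hyperbolic_form_def sum_distrib_left mult.assoc)
qed

text \<open>Serves both classes at once: the argument depends on \<open>q\<close> only through its
  polarization. The bound on \<open>n\<close> gives the dimension above 2 that
  \<open>linear_part_iso\<close> requires.\<close>

lemma Stab_iso_Sp:
  assumes i: "\<iota> * \<iota> = (-1 :: 'k::field_char_0)" and n: "n > 1"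
    and form: "bit_quadratic_form (2 * n) (symplectic_gram n) q"
    and p: "\<And>v. v \<in> carrier_vec (Suc (2 * n)) \<Longrightarrow>
      cubic_cochain (Suc (2 * n)) p (v, v, v) = homogenize (2 * n) q v"
  shows "Stab (Suc (2 * n)) (cubic_class (Suc (2 * n)) p :: (_ \<Rightarrow> 'k) set) \<cong> (Sp n :: bit mat monoid)"
proof -
  interpret bit_quadratic_form "2 * n" "symplectic_gram n" q by (rule form)
  have "M *\<^sub>v v \<in> carrier_vec (Suc (2 * n))"
    if "M \<in> carrier (GL (Suc (2 * n)))" "v \<in> carrier_vec (Suc (2 * n))" for M :: "bit mat" and v
    using that by (auto simp: carrier_GL_iff)
  then have "Stab (Suc (2 * n)) (cubic_class (Suc (2 * n)) p :: (_ \<Rightarrow> 'k) set) =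
      (GL (Suc (2 * n)))\<lparr>carrier := stabilizer\<rparr>"
    unfolding Stab_cubic_class[OF i] stabilizer_def
    by (intro arg_cong[where f = "\<lambda>c. (GL _)\<lparr>carrier := c\<rparr>"] Collect_cong) (auto simp: p)
  then show ?thesis
    using linear_part_iso n unfolding Sp_def is_iso_def by auto
qed

theorem proposition6p11:
  fixes n :: nat
    and omega_D omega_Q ::
      "(bit vec \<times> bit vec \<times> bit vec \<Rightarrow> 'k::{alg_closed_field, field_char_0}) set"
  assumes "n > 1"
    and "omega_D = cubic_class (2 * n + 1) (\<Sum>i=1..n. X 0 * X (2 * i - 1) * X (2 * i))"
    and "omega_Q = cubic_class (2 * n + 1)
      ((\<Sum>i=1..n. X 0 * X (2 * i - 1) * X (2 * i)) + X 0 * X 1 ^ 2 + X 0 * X 2 ^ 2)"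
  shows "Stab (2 * n + 1) omega_D \<cong> (Sp n :: bit mat monoid) \<and>
    Stab (2 * n + 1) omega_Q \<cong> (Sp n :: bit mat monoid)"
proof -
  let ?m = "Suc (2 * n)" and ?D = "\<Sum>i=1..n. X 0 * X (2 * i - 1) * X (2 * i)"
  \<comment> \<open>Algebraic closedness enters here, through the square root of -1 used in
    \<open>cohomologous_monomials_collapse\<close>.\<close>
  obtain \<iota> :: 'k where "\<iota> ^ 2 = - 1"
    using nth_root_exists[of 2 "- 1 :: 'k"] by auto
  then have i: "\<iota> * \<iota> = - 1" by (simp add: power2_eq_square)
  \<comment> \<open>On F_2-points x_1^2 + x_2^2 equals x_1 + x_2; the indices drop by one because
    coordinate 0 is split off.\<close>
  let ?l = "\<lambda>x :: bit vec. x $ 0 + x $ 1"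
  have Q: "cubic_cochain ?m (?D + X 0 * X 1 ^ 2 + X 0 * X 2 ^ 2) (v, v, v) =
      homogenize (2 * n) (\<lambda>x. hyperbolic_form n x + ?l x) v"
    if "v \<in> carrier_vec ?m" for v
  proof -
    have "cubic_cochain ?m (?D + X 0 * X 1 ^ 2 + X 0 * X 2 ^ 2) (v, v, v) =
        homogenize (2 * n) (hyperbolic_form n) v + v $ 0 * v $ 1 * v $ 1 + v $ 0 * v $ 2 * v $ 2"
      using cubic_cochain_hyperbolic[OF that] \<open>n > 1\<close>
      by (simp add: cubic_cochain_poly_add power2_eq_square cubic_cochain_monomial flip: mult.assoc)
    then show ?thesis
      using \<open>n > 1\<close>
      by (simp add: homogenize_def distrib_left numeral_2_eq_2 ac_simps)
  qed
  have "bit_quadratic_form (2 * n) (symplectic_gram n) (\<lambda>x. hyperbolic_form n x + ?l x)"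
    using \<open>n > 1\<close>
    by (intro bit_quadratic_form_add_linear bit_quadratic_form_hyperbolic) (auto simp: ac_simps)
  then have "Stab (2 * n + 1) omega_Q \<cong> (Sp n :: bit mat monoid)"
    unfolding assms(3) Suc_eq_plus1[symmetric] using Q by (intro Stab_iso_Sp[OF i \<open>n > 1\<close>])
  moreover have "Stab (2 * n + 1) omega_D \<cong> (Sp n :: bit mat monoid)"
    unfolding assms(2) Suc_eq_plus1[symmetric]
    by (rule Stab_iso_Sp[OF i \<open>n > 1\<close> bit_quadratic_form_hyperbolic]) (rule cubic_cochain_hyperbolic)
  ultimately show ?thesis by blast
qed

end
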